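(* Let $\mathbb{F}$ be a field and $c\ge1$, let $L$ be an LLA over $\mathbb{F}$ of class $\le c$, let $E\subseteq C$ be sub-LLAs of $L$, and let $a=(a_1,\dots,a_n)$, $b=(b_1,\dots,b_m)$ be tuples from $L$ which are both Malcev over $C$ and Malcev over $E$. If $a\mathop{\smile\!\!\!\!\!\mid}^{\otimes}_C b$, then $a\mathop{\smile\!\!\!\!\!\mid}^{\otimes}_E b$.
   Context: An LLA over $\mathbb{F}$ of class $\le c$ is a Lie algebra $L$ over $\mathbb{F}$ with subalgebras $L=P_1(L)\supseteq\dots\supseteq P_{c+1}(L)=0$ such that $[P_i,P_j]\subseteq P_{i+j}$ (with $P_k=0$ for $k>c$); sub-LLAs carry the induced series; homomorphisms are Lie homomorphisms preserving each $P_i$. $\langle X\rangle$ is the sub-LLA generated by $X$. A tuple $a$ is Malcev over a sub-LLA $C$ if $a$ is linearly independent over $C$ and for all $i=1,\dots,c$, $\operatorname{span}_{\mathbb{F}}(C\cup P_i(\langle Ca\rangle))=\operatorname{span}_{\mathbb{F}}(C\cup P_i(a))$, with $P_i(a)$ the subtuple of entries in $P_i$. A free amalgam of LLAs $A,B$ over a common sub-LLA $D$ is an LLA $S$ with embeddings of $A,B$ agreeing on $D$, generated by the images of $A$ and $B$, in which the images intersect exactly in $D$, and such that any two LLA homomorphisms from $A$ and $B$ to an LLA that agree on $D$ extend to a (unique) homomorphism from $S$. For subsets $X,Y$ and a sub-LLA $D$ of $L$, $X\mathop{\smile\!\!\!\!\!\mid}^{\otimes}_D Y$ means that $\langle XYD\rangle$,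 with the inclusions of $\langle XD\rangle$ and $\langle YD\rangle$, is a free amalgam of $\langle XD\rangle$ and $\langle YD\rangle$ over $D$. *)

theory Defs
  imports Complex_Main "HOL-Library.Poly_Mapping"
begin

text \<open>
  An LLA is a Lie algebra with a series of layers \<open>P\<^sub>1 \<supseteq> P\<^sub>2 \<supseteq> \<dots>\<close>. Its carrier is
  \<open>P\<^sub>1\<close>, a subspace of an ambient vector space; the bracket is unconstrained outside
  the carrier, and the value of \<open>layer\<close> at index \<open>0\<close> is irrelevant throughout.
\<close>

record ('f, 'a) lla =
  smult :: "'f \<Rightarrow> 'a \<Rightarrow> 'a"
  bracket :: "'a \<Rightarrow> 'a \<Rightarrow> 'a"
  layer :: "nat \<Rightarrow> 'a set"

abbreviation carrier :: "('f, 'a) lla \<Rightarrow> 'a set"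
  where "carrier L \<equiv> layer L 1"

definition lie_algebra_on :: "('f::field \<Rightarrow> 'a::ab_group_add \<Rightarrow> 'a) \<Rightarrow> ('a \<Rightarrow> 'a \<Rightarrow> 'a) \<Rightarrow> 'a set \<Rightarrow> bool"
  where "lie_algebra_on s br G \<longleftrightarrow>
    vector_space s \<and> module.subspace s G \<and>
    (\<forall>x\<in>G. \<forall>y\<in>G. br x y \<in> G) \<and>
    (\<forall>x\<in>G. \<forall>y\<in>G. \<forall>z\<in>G. br (x + y) z = br x z + br y z \<and> br z (x + y) = br z x + br z y) \<and>
    (\<forall>r. \<forall>x\<in>G. \<forall>y\<in>G. br (s r x) y = s r (br x y) \<and> br x (s r y) = s r (br x y)) \<and>
    (\<forall>x\<in>G. br x x = 0) \<and>
    (\<forall>x\<in>G. \<forall>y\<in>G. \<forall>z\<in>G. br x (br y z) + br y (br z x) + br z (br x y) = 0)"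

text \<open>
  Sub-LLAs are given by their underlying sets; the series they carry is the induced one
  (\<open>induced_lla\<close> below).
\<close>

definition sub_lla :: "('f::field, 'a::ab_group_add) lla \<Rightarrow> 'a set \<Rightarrow> bool"
  where "sub_lla L D \<longleftrightarrow>
    D \<subseteq> carrier L \<and> module.subspace (smult L) D \<and> (\<forall>x\<in>D. \<forall>y\<in>D. bracket L x y \<in> D)"

definition is_lla :: "nat \<Rightarrow> ('f::field, 'a::ab_group_add) lla \<Rightarrow> bool"
  where "is_lla c L \<longleftrightarrow>
    lie_algebra_on (smult L) (bracket L) (carrier L) \<and>
    (\<forall>i\<ge>1. sub_lla L (layer L i)) \<and>
    (\<forall>i\<ge>1. layer L (Suc i) \<subseteq> layer L i) \<and>
    (\<forall>i>c. layer L i = {0}) \<and>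
    (\<forall>i\<ge>1. \<forall>j\<ge>1. \<forall>x\<in>layer L i. \<forall>y\<in>layer L j. bracket L x y \<in> layer L (i + j))"

definition induced_lla :: "('f, 'a) lla \<Rightarrow> 'a set \<Rightarrow> ('f, 'a) lla"
  where "induced_lla L D = L\<lparr>layer := \<lambda>i. layer L i \<inter> D\<rparr>"

definition generated_lla :: "('f::field, 'a::ab_group_add) lla \<Rightarrow> 'a set \<Rightarrow> 'a set"
  where "generated_lla L X = sub_lla L hull X"

definition lla_hom ::
    "('f::field, 'a::ab_group_add) lla \<Rightarrow> ('f, 'b::ab_group_add) lla \<Rightarrow> ('a \<Rightarrow> 'b) \<Rightarrow> bool"
  where "lla_hom A B f \<longleftrightarrow>
    (\<forall>x\<in>carrier A. \<forall>y\<in>carrier A. f (x + y) = f x + f y) \<and>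
    (\<forall>r. \<forall>x\<in>carrier A. f (smult A r x) = smult B r (f x)) \<and>
    (\<forall>x\<in>carrier A. \<forall>y\<in>carrier A. f (bracket A x y) = bracket B (f x) (f y)) \<and>
    (\<forall>i\<ge>1. f ` layer A i \<subseteq> layer B i)"

text \<open>
  An embedding is an isomorphism onto a sub-LLA with its induced series, so it reflects the
  layers as well.
\<close>

definition lla_embedding ::
    "('f::field, 'a::ab_group_add) lla \<Rightarrow> ('f, 'b::ab_group_add) lla \<Rightarrow> ('a \<Rightarrow> 'b) \<Rightarrow> bool"
  where "lla_embedding A B f \<longleftrightarrow>
    lla_hom A B f \<and> inj_on f (carrier A) \<and>
    (\<forall>i\<ge>1. \<forall>x\<in>carrier A. f x \<in> layer B i \<longrightarrow> x \<in> layer A i)"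

definition common_sub_lla ::
    "('f::field, 'a::ab_group_add) lla \<Rightarrow> ('f, 'a) lla \<Rightarrow> 'a set \<Rightarrow> bool"
  where "common_sub_lla A B D \<longleftrightarrow>
    sub_lla A D \<and> sub_lla B D \<and>
    (\<forall>r. \<forall>x\<in>D. smult A r x = smult B r x) \<and>
    (\<forall>x\<in>D. \<forall>y\<in>D. bracket A x y = bracket B x y) \<and>
    (\<forall>i\<ge>1. layer A i \<inter> D = layer B i \<inter> D)"

definition linearly_independent_over ::
    "('f::field, 'a::ab_group_add) lla \<Rightarrow> 'a set \<Rightarrow> 'a list \<Rightarrow> bool"
  where "linearly_independent_over L C a \<longleftrightarrow>
    (\<forall>r. (\<Sum>k<length a. smult L (r k) (a ! k)) \<in> C \<longrightarrow> (\<forall>k<length a. r k = 0))"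

definition malcev :: "nat \<Rightarrow> ('f::field, 'a::ab_group_add) lla \<Rightarrow> 'a set \<Rightarrow> 'a list \<Rightarrow> bool"
  where "malcev c L C a \<longleftrightarrow>
    linearly_independent_over L C a \<and>
    (\<forall>i\<in>{1..c}.
      module.span (smult L) (C \<union> (layer L i \<inter> generated_lla L (C \<union> set a))) =
      module.span (smult L) (C \<union> (layer L i \<inter> set a)))"

text \<open>
  A HOL definition cannot quantify over types, so the type \<open>'t\<close> in which the test LLAs \<open>T\<close>
  of the universal property live is an explicit parameter.  The notion itself is freeness
  for all \<open>'t\<close>.
\<close>

definition free_amalgam ::
    "'t::ab_group_add itself \<Rightarrow> nat \<Rightarrow> ('f::field, 's::ab_group_add) lla \<Rightarrow>
     ('f, 'a::ab_group_add) lla \<Rightarrow> ('a \<Rightarrow> 's) \<Rightarrow> ('f, 'a) lla \<Rightarrow> ('a \<Rightarrow> 's) \<Rightarrow> 'a set \<Rightarrow> bool"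
  where "free_amalgam _ c S A \<alpha> B \<beta> D \<longleftrightarrow>
    is_lla c S \<and> is_lla c A \<and> is_lla c B \<and> common_sub_lla A B D \<and>
    lla_embedding A S \<alpha> \<and> lla_embedding B S \<beta> \<and> (\<forall>d\<in>D. \<alpha> d = \<beta> d) \<and>
    generated_lla S (\<alpha> ` carrier A \<union> \<beta> ` carrier B) = carrier S \<and>
    \<alpha> ` carrier A \<inter> \<beta> ` carrier B = \<alpha> ` D \<and>
    (\<forall>(T :: ('f, 't) lla) f g.
      is_lla c T \<and> lla_hom A T f \<and> lla_hom B T g \<and> (\<forall>d\<in>D. f d = g d) \<longrightarrow>
      (\<exists>h. (lla_hom S T h \<and> (\<forall>x\<in>carrier A. h (\<alpha> x) = f x) \<and> (\<forall>x\<in>carrier B. h (\<beta> x) = g x)) \<and>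
           (\<forall>h'. lla_hom S T h' \<and> (\<forall>x\<in>carrier A. h' (\<alpha> x) = f x) \<and> (\<forall>x\<in>carrier B. h' (\<beta> x) = g x)
             \<longrightarrow> (\<forall>x\<in>carrier S. h' x = h x))))"

definition free_indep ::
    "'t::ab_group_add itself \<Rightarrow> nat \<Rightarrow> ('f::field, 'a::ab_group_add) lla \<Rightarrow>
     'a set \<Rightarrow> 'a set \<Rightarrow> 'a set \<Rightarrow> bool"
  where "free_indep t c L D X Y \<longleftrightarrow>
    free_amalgam t c
      (induced_lla L (generated_lla L (X \<union> Y \<union> D)))
      (induced_lla L (generated_lla L (X \<union> D))) id
      (induced_lla L (generated_lla L (Y \<union> D))) id
      D"

text \<open>
  In the universal property of an amalgam of \<open>A\<close> and \<open>B\<close>, the test LLA \<open>T\<close> may be replaced by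
  the sub-LLA generated by the images of \<open>A\<close> and \<open>B\<close>.  That one is spanned by left-normed
  brackets of elements of these images, so it has a copy inside the vector space with the words
  over \<open>A + B\<close> as a basis.  Testing on the following type is thus enough for freeness over
  every type \<open>'t\<close>.
\<close>

type_synonym ('f, 'a) test_universe = "('a + 'a) list \<Rightarrow>\<^sub>0 'f"

end

theory Submission
  imports Defs "HOL-Library.Function_Algebras" "HOL-Library.Product_Plus"
begin

text \<open>
  Let \<open>A = \<langle>Ea\<rangle>\<close>, \<open>A' = \<langle>Ca\<rangle>\<close>, and \<open>B\<close>, \<open>B'\<close> likewise for \<open>b\<close>. The Malcev conditions say that
  \<open>P\<^sub>j(A') \<subseteq> A + P\<^sub>j(C)\<close> for all \<open>j\<close> and that \<open>A \<inter> C = E\<close>. Hence the \<open>A\<^sub>j = A + P\<^sub>j(C)\<close> and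
  \<open>B\<^sub>j = B + P\<^sub>j(C)\<close> are chains of subalgebras from \<open>A'\<close>, \<open>B'\<close> down to \<open>A\<close>, \<open>B\<close>, each an ideal in the
  previous one, and the universal property descends one step at a time.

  For one step, let \<open>U\<close> be the universal amalgam of \<open>A\<^sub>j\<^sub>+\<^sub>1\<close> and \<open>B\<^sub>j\<^sub>+\<^sub>1\<close> and let \<open>D\<close> be a complement of the
  smaller base in the larger one. Each \<open>d \<in> D\<close> acts by derivations on \<open>A\<^sub>j\<^sub>+\<^sub>1\<close> and \<open>B\<^sub>j\<^sub>+\<^sub>1\<close>, hence on
  \<open>U\<close>: apply the universal property to dual numbers over \<open>U\<close>. So \<open>U\<close> extends to an LLA on \<open>U \<times> D\<close>
  that receives \<open>A\<^sub>j\<close> and \<open>B\<^sub>j\<close>, and the freeness of \<open>\<langle>A\<^sub>j B\<^sub>j\<rangle>\<close> yields a homomorphism into it, which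
  maps \<open>\<langle>A\<^sub>j\<^sub>+\<^sub>1 B\<^sub>j\<^sub>+\<^sub>1\<rangle>\<close> to \<open>U\<close>.
\<close>

text \<open>\<open>carrier L\<close> abbreviates \<open>layer L 1\<close>, so simp rules about
  carriers match only while 1 is not rewritten to \<open>Suc 0\<close>.\<close>

declare One_nat_def [simp del]

section \<open>Basic facts about LLAs\<close>

text \<open>Antisymmetry turns linearity in the first argument into linearity in the second, so each
  construction below checks one side only. The layers are subalgebras because i + i \<ge> i.\<close>

lemma is_llaI:
  assumes "vector_space (smult L)"
    and "\<And>i. i \<ge> 1 \<Longrightarrow> module.subspace (smult L) (layer L i)"
    and dec: "\<And>i. i \<ge> 1 \<Longrightarrow> layer L (Suc i) \<subseteq> layer L i"
    and above: "\<And>i. i > c \<Longrightarrow> layer L i = {0}"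
    and br: "\<And>i j x y. i \<ge> 1 \<Longrightarrow> j \<ge> 1 \<Longrightarrow> x \<in> layer L i \<Longrightarrow> y \<in> layer L j \<Longrightarrow>
      bracket L x y \<in> layer L (i + j)"
    and add: "\<And>x y z. x \<in> carrier L \<Longrightarrow> y \<in> carrier L \<Longrightarrow> z \<in> carrier L \<Longrightarrow>
      bracket L (x + y) z = bracket L x z + bracket L y z"
    and scale: "\<And>r x y. x \<in> carrier L \<Longrightarrow> y \<in> carrier L \<Longrightarrow>
      bracket L (smult L r x) y = smult L r (bracket L x y)"
    and alt: "\<And>x. x \<in> carrier L \<Longrightarrow> bracket L x x = 0"
    and anti: "\<And>x y. x \<in> carrier L \<Longrightarrow> y \<in> carrier L \<Longrightarrow> bracket L x y = - bracket L y x"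
    and jacobi: "\<And>x y z. x \<in> carrier L \<Longrightarrow> y \<in> carrier L \<Longrightarrow> z \<in> carrier L \<Longrightarrow>
      bracket L x (bracket L y z) + bracket L y (bracket L z x) + bracket L z (bracket L x y) = 0"
  shows "is_lla c L"
proof -
  interpret vector_space "smult L" by fact
  have sub: "layer L i \<subseteq> layer L j" if "j \<ge> 1" "j \<le> i" for i j
    using that(2)
  proof (induction rule: dec_induct)
    case (step n)
    then show ?case
      using dec[of n] that(1) by auto
  qed simp
  have br1: "bracket L x y \<in> layer L i" if "i \<ge> 1" "x \<in> layer L i" "y \<in> layer L i" for i x y
    using br[of i i x y] that sub[of i "i + i"] by auto
  have add_right: "bracket L z (x + y) = bracket L z x + bracket L z y"
    if "x \<in> carrier L" "y \<in> carrier L" "z \<in> carrier L" for x y z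
  proof -
    have "x + y \<in> carrier L"
      using that assms(2)[of 1] by (auto simp: subspace_def)
    thus ?thesis
      using that add anti[of z "x + y"] anti[of z x] anti[of z y] by simp
  qed
  have scale_right: "bracket L z (smult L r x) = smult L r (bracket L z x)"
    if "x \<in> carrier L" "z \<in> carrier L" for x z r
  proof -
    have "smult L r x \<in> carrier L"
      using that assms(2)[of 1] by (auto simp: subspace_def)
    thus ?thesis
      using that scale anti[of z "smult L r x"] anti[of z x] by (simp add: scale_minus_right)
  qed
  have "lie_algebra_on (smult L) (bracket L) (carrier L)"
    unfolding lie_algebra_on_def
    using assms(1) assms(2)[of 1] br1[of 1] add add_right scale scale_right alt jacobi by simp
  moreover have "sub_lla L (layer L i)" if "i \<ge> 1" for i
    unfolding sub_lla_def using sub[of 1 i] assms(2)[of i] br1[of i] that by auto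
  ultimately show ?thesis
    unfolding is_lla_def using dec above br by simp
qed

locale lla =
  fixes c :: nat and L :: "('f::field, 'a::ab_group_add) lla"
  assumes is_lla: "is_lla c L"
begin

lemma lie: "lie_algebra_on (smult L) (bracket L) (carrier L)"
  using is_lla by (simp add: is_lla_def)

sublocale vector_space "smult L"
  using lie by (simp add: lie_algebra_on_def)

lemma subspace_carrier: "subspace (carrier L)"
  using lie by (simp add: lie_algebra_on_def)

lemma subspace_layer: "i \<ge> 1 \<Longrightarrow> subspace (layer L i)"
  using is_lla by (simp add: is_lla_def sub_lla_def)

lemma layer_carrier: "i \<ge> 1 \<Longrightarrow> x \<in> layer L i \<Longrightarrow> x \<in> carrier L"
  using is_lla by (auto simp: is_lla_def sub_lla_def)

lemma layer_above: "i > c \<Longrightarrow> layer L i = {0}"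
  using is_lla by (simp add: is_lla_def)

lemma layer_decreasing:
  assumes "j \<ge> 1" "j \<le> i"
  shows "layer L i \<subseteq> layer L j"
  using assms(2)
proof (induction rule: dec_induct)
  case (step n)
  then have "layer L (Suc n) \<subseteq> layer L n"
    using is_lla assms(1) by (simp add: is_lla_def)
  with step show ?case by auto
qed simp

lemma bracket_layer:
  "i \<ge> 1 \<Longrightarrow> j \<ge> 1 \<Longrightarrow> x \<in> layer L i \<Longrightarrow> y \<in> layer L j \<Longrightarrow> bracket L x y \<in> layer L (i + j)"
  using is_lla by (simp add: is_lla_def)

lemma bracket_carrier [simp]: "x \<in> carrier L \<Longrightarrow> y \<in> carrier L \<Longrightarrow> bracket L x y \<in> carrier L"
  using lie by (simp add: lie_algebra_on_def)

lemma add_carrier [simp]: "x \<in> carrier L \<Longrightarrow> y \<in> carrier L \<Longrightarrow> x + y \<in> carrier L"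
  using subspace_carrier by (rule subspace_add)

lemma diff_carrier [simp]: "x \<in> carrier L \<Longrightarrow> y \<in> carrier L \<Longrightarrow> x - y \<in> carrier L"
  using subspace_carrier by (rule subspace_diff)

lemma minus_carrier [simp]: "x \<in> carrier L \<Longrightarrow> - x \<in> carrier L"
  using subspace_carrier by (rule subspace_neg)

lemma scale_carrier [simp]: "x \<in> carrier L \<Longrightarrow> smult L r x \<in> carrier L"
  using subspace_carrier by (rule subspace_scale)

lemma zero_carrier [simp]: "0 \<in> carrier L"
  using subspace_carrier by (rule subspace_0)

lemma bracket_add_left [simp]:
  "x \<in> carrier L \<Longrightarrow> y \<in> carrier L \<Longrightarrow> z \<in> carrier L \<Longrightarrow>
    bracket L (x + y) z = bracket L x z + bracket L y z"
  and bracket_add_right [simp]: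
  "x \<in> carrier L \<Longrightarrow> y \<in> carrier L \<Longrightarrow> z \<in> carrier L \<Longrightarrow>
    bracket L z (x + y) = bracket L z x + bracket L z y"
  and bracket_scale_left [simp]:
  "x \<in> carrier L \<Longrightarrow> y \<in> carrier L \<Longrightarrow> bracket L (smult L r x) y = smult L r (bracket L x y)"
  and bracket_scale_right [simp]:
  "x \<in> carrier L \<Longrightarrow> y \<in> carrier L \<Longrightarrow> bracket L x (smult L r y) = smult L r (bracket L x y)"
  and bracket_self [simp]: "x \<in> carrier L \<Longrightarrow> bracket L x x = 0"
  and jacobi: "x \<in> carrier L \<Longrightarrow> y \<in> carrier L \<Longrightarrow> z \<in> carrier L \<Longrightarrow>
    bracket L x (bracket L y z) + bracket L y (bracket L z x) + bracket L z (bracket L x y) = 0"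
  using lie by (simp_all add: lie_algebra_on_def)

lemma bracket_minus_left [simp]:
  "x \<in> carrier L \<Longrightarrow> y \<in> carrier L \<Longrightarrow> bracket L (- x) y = - bracket L x y"
  using bracket_scale_left[of x y "- 1"] by (simp add: scale_minus_left)

lemma bracket_minus_right [simp]:
  "x \<in> carrier L \<Longrightarrow> y \<in> carrier L \<Longrightarrow> bracket L x (- y) = - bracket L x y"
  using bracket_scale_right[of x y "- 1"] by (simp add: scale_minus_left)

lemma bracket_diff_left [simp]:
  "x \<in> carrier L \<Longrightarrow> y \<in> carrier L \<Longrightarrow> z \<in> carrier L \<Longrightarrow>
    bracket L (x - y) z = bracket L x z - bracket L y z"
  using bracket_add_left[of x "- y" z] by simp

lemma bracket_diff_right [simp]:
  "x \<in> carrier L \<Longrightarrow> y \<in> carrier L \<Longrightarrow> z \<in> carrier L \<Longrightarrow>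
    bracket L z (x - y) = bracket L z x - bracket L z y"
  using bracket_add_right[of x "- y" z] by simp

lemma bracket_zero_left [simp]: "x \<in> carrier L \<Longrightarrow> bracket L 0 x = 0"
  using bracket_scale_left[of 0 x 0] by simp

lemma bracket_zero_right [simp]: "x \<in> carrier L \<Longrightarrow> bracket L x 0 = 0"
  using bracket_scale_right[of x 0 0] by simp

lemma bracket_anti:
  assumes "x \<in> carrier L" "y \<in> carrier L"
  shows "bracket L x y = - bracket L y x"
proof -
  have "bracket L x y + bracket L y x = bracket L x (x + y) + bracket L y (x + y)"
    using assms by simp
  also have "\<dots> = bracket L (x + y) (x + y)"
    using assms by (intro bracket_add_left[symmetric]) simp_all
  also have "\<dots> = 0"
    using assms by (intro bracket_self) simp
  finally have "bracket L x y + bracket L y x = 0" .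
  thus ?thesis by (simp add: eq_neg_iff_add_eq_0)
qed

text \<open>The Jacobi identity read as ad [x,y] = [ad x, ad y]; the next lemma reads it as the
  derivation rule for ad x.\<close>

lemma bracket_bracket_left:
  assumes "x \<in> carrier L" "y \<in> carrier L" "z \<in> carrier L"
  shows "bracket L (bracket L x y) z = bracket L x (bracket L y z) - bracket L y (bracket L x z)"
  using jacobi[OF assms] assms bracket_anti[of z "bracket L x y"] bracket_anti[of z x]
  by (simp add: algebra_simps eq_neg_iff_add_eq_0)

lemma bracket_bracket_right:
  assumes "x \<in> carrier L" "y \<in> carrier L" "z \<in> carrier L"
  shows "bracket L x (bracket L y z) = bracket L (bracket L x y) z + bracket L y (bracket L x z)"
  using bracket_bracket_left[OF assms] by simp

end

section \<open>Sub-LLAs, generation and induced series\<close>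

lemma sub_lla_carrier: "sub_lla L D \<Longrightarrow> D \<subseteq> carrier L"
  by (simp add: sub_lla_def)

context lla
begin

lemma sub_lla_carrier_self: "sub_lla L (carrier L)"
  by (simp add: sub_lla_def subspace_carrier)

lemma sub_lla_subspace: "sub_lla L D \<Longrightarrow> subspace D"
  by (simp add: sub_lla_def)

lemma sub_lla_bracket: "sub_lla L D \<Longrightarrow> x \<in> D \<Longrightarrow> y \<in> D \<Longrightarrow> bracket L x y \<in> D"
  by (simp add: sub_lla_def)

lemma sub_lla_Inter: "F \<noteq> {} \<Longrightarrow> (\<And>D. D \<in> F \<Longrightarrow> sub_lla L D) \<Longrightarrow> sub_lla L (\<Inter>F)"
  unfolding sub_lla_def by (intro conjI subspace_Inter; blast)

lemma sub_lla_Int: "sub_lla L D \<Longrightarrow> sub_lla L D' \<Longrightarrow> sub_lla L (D \<inter> D')"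
  using sub_lla_Inter[of "{D, D'}"] by auto

lemma sub_lla_generated: "X \<subseteq> carrier L \<Longrightarrow> sub_lla L (generated_lla L X)"
  unfolding generated_lla_def hull_def
  by (rule sub_lla_Inter) (use sub_lla_carrier_self in auto)

end

lemma generated_incl: "X \<subseteq> generated_lla L X"
  unfolding generated_lla_def by (rule hull_subset)

lemma generated_minimal: "X \<subseteq> D \<Longrightarrow> sub_lla L D \<Longrightarrow> generated_lla L X \<subseteq> D"
  unfolding generated_lla_def by (rule hull_minimal)

lemma generated_mono: "X \<subseteq> Y \<Longrightarrow> generated_lla L X \<subseteq> generated_lla L Y"
  unfolding generated_lla_def by (rule hull_mono)

lemma induced_simps [simp]:
  "smult (induced_lla L D) = smult L"
  "bracket (induced_lla L D) = bracket L"
  "layer (induced_lla L D) i = layer L i \<inter> D"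
  by (simp_all add: induced_lla_def)

lemma (in lla) is_lla_induced:
  assumes "sub_lla L D"
  shows "is_lla c (induced_lla L D)"
proof (rule is_llaI)
  note [simp] = subspace_layer
  have D: "subspace D" using assms by (rule sub_lla_subspace)
  show "module.subspace (smult (induced_lla L D)) (layer (induced_lla L D) i)" if "i \<ge> 1" for i
    using D that by (auto intro!: subspace_inter)
  show "layer (induced_lla L D) (Suc i) \<subseteq> layer (induced_lla L D) i" if "i \<ge> 1" for i
    using that layer_decreasing[of i "Suc i"] by auto
  show "layer (induced_lla L D) i = {0}" if "i > c" for i
    using that layer_above[of i] subspace_0[OF D] by auto
  show "bracket (induced_lla L D) x y = - bracket (induced_lla L D) y x"
    if "x \<in> carrier (induced_lla L D)" "y \<in> carrier (induced_lla L D)" for x y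
    using that bracket_anti[of x y] by simp
  show "bracket (induced_lla L D) x y \<in> layer (induced_lla L D) (i + j)"
    if "i \<ge> 1" "j \<ge> 1" "x \<in> layer (induced_lla L D) i" "y \<in> layer (induced_lla L D) j" for i j x y
    using that bracket_layer[of i j x y] sub_lla_bracket[OF assms, of x y] by simp
qed (simp_all add: jacobi vector_space_axioms)

lemma sub_lla_induced: "sub_lla (induced_lla L D) D' \<longleftrightarrow> sub_lla L D' \<and> D' \<subseteq> D"
  by (auto simp: sub_lla_def)

lemma (in lla) generated_induced:
  assumes "X \<subseteq> D" "sub_lla L D"
  shows "generated_lla (induced_lla L D) X = generated_lla L X"
proof
  have "sub_lla L (generated_lla L X)"
    using assms sub_lla_carrier by (intro sub_lla_generated) blast
  thus "generated_lla (induced_lla L D) X \<subseteq> generated_lla L X"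
    using assms by (intro generated_minimal) (auto simp: sub_lla_induced generated_incl generated_minimal)
  interpret D: lla c "induced_lla L D"
    by unfold_locales (rule is_lla_induced[OF assms(2)])
  have "sub_lla (induced_lla L D) (generated_lla (induced_lla L D) X)"
    using assms sub_lla_carrier by (intro D.sub_lla_generated) auto
  thus "generated_lla L X \<subseteq> generated_lla (induced_lla L D) X"
    by (intro generated_minimal) (auto simp: sub_lla_induced generated_incl)
qed

section \<open>Homomorphisms\<close>

lemma lla_homI:
  assumes "\<And>x y. x \<in> carrier A \<Longrightarrow> y \<in> carrier A \<Longrightarrow> f (x + y) = f x + f y"
    and "\<And>r x. x \<in> carrier A \<Longrightarrow> f (smult A r x) = smult B r (f x)"
    and "\<And>x y. x \<in> carrier A \<Longrightarrow> y \<in> carrier A \<Longrightarrow> f (bracket A x y) = bracket B (f x) (f y)"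
    and "\<And>i x. i \<ge> 1 \<Longrightarrow> x \<in> layer A i \<Longrightarrow> f x \<in> layer B i"
  shows "lla_hom A B f"
  using assms by (auto simp: lla_hom_def)

lemma lla_hom_layer: "lla_hom A B f \<Longrightarrow> i \<ge> 1 \<Longrightarrow> x \<in> layer A i \<Longrightarrow> f x \<in> layer B i"
  unfolding lla_hom_def image_subset_iff by simp

lemma lla_hom_compose:
  assumes "lla_hom A B f" "lla_hom B C g"
  shows "lla_hom A C (\<lambda>x. g (f x))"
proof -
  have "f x \<in> layer B i" if "i \<ge> 1" "x \<in> layer A i" for i x
    using assms(1) that by (rule lla_hom_layer)
  thus ?thesis
    using assms unfolding lla_hom_def image_subset_iff by simp
qed

lemma lla_hom_into_induced:
  "lla_hom A (induced_lla B D) f \<longleftrightarrow> lla_hom A B f \<and> (\<forall>i\<ge>1. f ` layer A i \<subseteq> D)"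
  unfolding lla_hom_def image_subset_iff by auto

locale lla_homomorphism = A: lla c A + B: lla c B
  for c :: nat and A :: "('f::field, 'a::ab_group_add) lla"
    and B :: "('f, 'b::ab_group_add) lla" +
  fixes f :: "'a \<Rightarrow> 'b"
  assumes hom: "lla_hom A B f"
begin

lemma map_layer: "i \<ge> 1 \<Longrightarrow> x \<in> layer A i \<Longrightarrow> f x \<in> layer B i"
  using hom by (rule lla_hom_layer)

lemma map_carrier [simp]: "x \<in> carrier A \<Longrightarrow> f x \<in> carrier B"
  by (rule map_layer) simp_all

lemma map_add [simp]: "x \<in> carrier A \<Longrightarrow> y \<in> carrier A \<Longrightarrow> f (x + y) = f x + f y"
  and map_scale [simp]: "x \<in> carrier A \<Longrightarrow> f (smult A r x) = smult B r (f x)"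
  and map_bracket [simp]: "x \<in> carrier A \<Longrightarrow> y \<in> carrier A \<Longrightarrow> f (bracket A x y) = bracket B (f x) (f y)"
  using hom by (auto simp: lla_hom_def)

lemma map_zero [simp]: "f 0 = 0"
  using map_add[of 0 0] by simp

lemma map_minus [simp]: "x \<in> carrier A \<Longrightarrow> f (- x) = - f x"
  using map_scale[of x "- 1"] by (simp add: A.scale_minus_left B.scale_minus_left)

lemma map_diff [simp]: "x \<in> carrier A \<Longrightarrow> y \<in> carrier A \<Longrightarrow> f (x - y) = f x - f y"
  using map_add[of x "- y"] by simp

lemma sub_lla_preimage:
  assumes "sub_lla B D"
  shows "sub_lla A {x \<in> carrier A. f x \<in> D}"
  unfolding sub_lla_def
  using B.sub_lla_bracket[OF assms] B.sub_lla_subspace[OF assms]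
  by (auto simp: A.subspace_def B.subspace_def)

lemma map_generated:
  assumes "X \<subseteq> carrier A" "sub_lla B D" "f ` X \<subseteq> D" "x \<in> generated_lla A X"
  shows "f x \<in> D"
  using generated_minimal[OF _ sub_lla_preimage[OF assms(2)], of X] assms by auto

end

text \<open>The equaliser of two homomorphisms is a sub-LLA.\<close>

lemma hom_eq_on_generated:
  assumes "is_lla c A" "is_lla c B" "lla_hom A B f" "lla_hom A B g"
    and "X \<subseteq> carrier A" "\<And>x. x \<in> X \<Longrightarrow> f x = g x" "x \<in> generated_lla A X"
  shows "f x = g x"
proof -
  interpret f: lla_homomorphism c A B f by unfold_locales (use assms in auto)
  interpret g: lla_homomorphism c A B g by unfold_locales (use assms in auto)
  have "sub_lla A {x \<in> carrier A. f x = g x}"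
    unfolding sub_lla_def by (auto simp: f.A.subspace_def)
  hence "generated_lla A X \<subseteq> {x \<in> carrier A. f x = g x}"
    using assms by (intro generated_minimal) auto
  thus ?thesis using assms by auto
qed

section \<open>Copies inside the test universe\<close>

definition pm_scale :: "'f::field \<Rightarrow> ('k \<Rightarrow>\<^sub>0 'f) \<Rightarrow> ('k \<Rightarrow>\<^sub>0 'f)"
  where "pm_scale r p = Poly_Mapping.map ((*) r) p"

lemma lookup_pm_scale [simp]: "Poly_Mapping.lookup (pm_scale r p) k = r * Poly_Mapping.lookup p k"
  by (simp add: pm_scale_def Poly_Mapping.map.rep_eq when_def)

lemma vector_space_pm_scale: "vector_space pm_scale"
  by unfold_locales (auto intro!: poly_mapping_eqI simp: lookup_add algebra_simps)

text \<open>Choose a basis of the span inside N and a key for each basis vector. Since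
  \<open>val\<close> recovers the vector from its key, distinct basis vectors go to distinct unit
  vectors.\<close>

lemma (in vector_space) embed_span_into_poly_mapping:
  fixes val :: "'k \<Rightarrow> 'b"
  assumes "N \<subseteq> range val"
  obtains \<phi> :: "'b \<Rightarrow> ('k \<Rightarrow>\<^sub>0 'a)" where "Vector_Spaces.linear scale pm_scale \<phi>" "inj_on \<phi> (span N)"
proof -
  obtain B where B: "B \<subseteq> N" "independent B" "N \<subseteq> span B"
    by (rule maximal_independent_subset)
  define pick where "pick = inv val"
  have val_pick: "val (pick b) = b" if "b \<in> B" for b
    using that B assms unfolding pick_def by (metis f_inv_into_f subsetD)
  interpret pm: vector_space pm_scale by (rule vector_space_pm_scale)
  interpret vector_space_pair scale "pm_scale :: 'a \<Rightarrow> ('k \<Rightarrow>\<^sub>0 'a) \<Rightarrow> ('k \<Rightarrow>\<^sub>0 'a)"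
    by unfold_locales
  obtain \<phi> where \<phi>: "Vector_Spaces.linear scale pm_scale \<phi>"
      "\<And>b. b \<in> B \<Longrightarrow> \<phi> b = Poly_Mapping.single (pick b) 1"
    using linear_independent_extend[OF B(2), of "\<lambda>b. Poly_Mapping.single (pick b) 1"] by blast
  interpret \<phi>: Vector_Spaces.linear scale pm_scale \<phi> by (rule \<phi>(1))
  have "v = 0" if v: "v \<in> span B" and 0: "\<phi> v = 0" for v
  proof -
    define S where "S = {b. representation B v b \<noteq> 0}"
    have S: "finite S" "S \<subseteq> B"
      by (auto simp: S_def finite_representation intro: representation_ne_zero)
    have v_eq: "v = (\<Sum>b\<in>S. representation B v b *s b)"
      using sum_nonzero_representation_eq[OF B(2) v] by (simp add: S_def)
    have "representation B v b = 0" if b: "b \<in> S" for b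
    proof -
      have "\<phi> v = (\<Sum>b\<in>S. pm_scale (representation B v b) (Poly_Mapping.single (pick b) 1))"
        using S(2) by (subst v_eq) (auto simp: \<phi>.sum \<phi>.scale \<phi>(2) intro!: sum.cong)
      \<comment> \<open>Evaluation at the key \<open>pick b\<close> isolates the coefficient of
        \<open>b\<close>.\<close>
      hence "0 = (\<Sum>b'\<in>S. representation B v b' * (1 when pick b' = pick b))"
        using 0 by (simp add: poly_mapping_eq_iff fun_eq_iff lookup_sum lookup_single)
      also have "\<dots> = (\<Sum>b'\<in>S. if b' = b then representation B v b' else 0)"
      proof (rule sum.cong)
        fix b' assume "b' \<in> S"
        hence "pick b' = pick b \<longleftrightarrow> b' = b"
          using val_pick S(2) b by (metis subsetD)
        thus "representation B v b' * (1 when pick b' = pick b) =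
            (if b' = b then representation B v b' else 0)"
          by simp
      qed simp
      also have "\<dots> = representation B v b"
        using S(1) b by simp
      finally show ?thesis by simp
    qed
    thus ?thesis using v_eq by simp
  qed
  hence "inj_on \<phi> (span B)"
    by (subst \<phi>.inj_on_iff_eq_0) auto
  moreover have "span N = span B"
    using B by (metis span_mono span_span subset_antisym)
  ultimately show ?thesis using that[OF \<phi>(1)] by simp
qed

text \<open>The right-normed bracket [x1,[x2,[...,xn]]]. The case split makes a one-letter word its
  letter instead of a bracket with 0; the empty word has the default value 0.\<close>

primrec rbracket :: "('f, 'a::zero) lla \<Rightarrow> 'a list \<Rightarrow> 'a"
  where
    "rbracket L [] = 0"
  | "rbracket L (x # w) = (if w = [] then x else bracket L x (rbracket L w))"

context lla
begin

lemma rbracket_carrier: "set w \<subseteq> carrier L \<Longrightarrow> rbracket L w \<in> carrier L"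
  by (induction w) auto

text \<open>The span of the words is closed under brackets: bracketing with one letter only prolongs
  a word, and bracketing with a word on the left reduces to letters by ad [x,y] =
  [ad x, ad y].\<close>

lemma generated_subset_span_rbracket:
  assumes "Z \<subseteq> carrier L"
  shows "generated_lla L Z \<subseteq> span (rbracket L ` lists Z)"
proof -
  define W where "W = span (rbracket L ` lists Z)"
  have Z: "x \<in> carrier L" if "x \<in> Z" for x using that assms by auto
  have words: "rbracket L w \<in> carrier L" if "w \<in> lists Z" for w
    using that assms by (intro rbracket_carrier) auto
  have W: "subspace W" unfolding W_def by (rule subspace_span)
  note W_ops = subspace_0[OF W] subspace_add[OF W] subspace_diff[OF W] subspace_scale[OF W]
  have W_carrier: "v \<in> carrier L" if "v \<in> W" for v
    using that span_minimal[OF _ subspace_carrier, of "rbracket L ` lists Z"] words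
    unfolding W_def by blast
  have letter: "bracket L x v \<in> W" if x: "x \<in> Z" and v: "v \<in> W" for x v
  proof -
    have "v \<in> carrier L \<and> bracket L x v \<in> W"
      using v unfolding W_def
    proof (rule span_induct)
      show "subspace {v. v \<in> carrier L \<and> bracket L x v \<in> span (rbracket L ` lists Z)}"
        using W_ops Z[OF x] by (auto simp: subspace_def W_def)
      fix v assume "v \<in> rbracket L ` lists Z"
      then obtain w where w: "w \<in> lists Z" "v = rbracket L w" by auto
      show "v \<in> carrier L \<and> bracket L x v \<in> span (rbracket L ` lists Z)"
      proof (cases "w = []")
        case True
        thus ?thesis using w x Z W_ops by (simp add: W_def)
      next
        case False
        hence "bracket L x v = rbracket L (x # w)" using w by simp
        moreover have "rbracket L (x # w) \<in> rbracket L ` lists Z"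
          using w(1) x by (intro imageI) auto
        ultimately show ?thesis using w words by (simp only: span_base)
      qed
    qed
    thus ?thesis ..
  qed
  \<comment> \<open>The induction must leave \<open>v\<close> arbitrary, because one of the two
    resulting terms applies the hypothesis to [x,v].\<close>
  have word: "bracket L (rbracket L w) v \<in> W" if "w \<in> lists Z" "v \<in> W" for w v
    using that
  proof (induction w arbitrary: v)
    case Nil
    thus ?case using W_carrier W_ops by simp
  next
    case (Cons x w)
    show ?case
    proof (cases "w = []")
      case True
      thus ?thesis using Cons letter by simp
    next
      case False
      have x: "x \<in> Z" and w: "w \<in> lists Z"
        using Cons.hyps by auto
      have "bracket L (rbracket L (x # w)) v =
        bracket L x (bracket L (rbracket L w) v) - bracket L (rbracket L w) (bracket L x v)"
        using False Z[OF x] words[OF w] W_carrier[OF \<open>v \<in> W\<close>] by (simp add: bracket_bracket_left)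
      thus ?thesis using Cons letter W_ops by auto
    qed
  qed
  have "bracket L u v \<in> W" if u: "u \<in> W" and v: "v \<in> W" for u v
  proof -
    have "u \<in> carrier L \<and> bracket L u v \<in> W"
      using u unfolding W_def
    proof (rule span_induct)
      show "subspace {u. u \<in> carrier L \<and> bracket L u v \<in> span (rbracket L ` lists Z)}"
        using W_ops W_carrier[OF v] by (auto simp: subspace_def W_def)
    qed (use word v words in \<open>auto simp: W_def\<close>)
    thus ?thesis ..
  qed
  hence "sub_lla L W"
    using W W_carrier by (auto simp: sub_lla_def)
  moreover have "x \<in> W" if "x \<in> Z" for x
  proof -
    have "x = rbracket L [x]" by simp
    thus ?thesis using that unfolding W_def by (metis imageI lists.simps span_base)
  qed
  ultimately show ?thesis
    unfolding W_def[symmetric] by (intro generated_minimal) auto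
qed

end

definition transport_lla ::
    "('f \<Rightarrow> 'b \<Rightarrow> 'b) \<Rightarrow> ('a \<Rightarrow> 'b) \<Rightarrow> ('b \<Rightarrow> 'a) \<Rightarrow> ('f, 'a) lla \<Rightarrow> ('f, 'b) lla"
  where "transport_lla s \<phi> \<psi> T =
    \<lparr>smult = s, bracket = \<lambda>x y. \<phi> (bracket T (\<psi> x) (\<psi> y)), layer = \<lambda>i. \<phi> ` layer T i\<rparr>"

lemma transport_simps [simp]:
  "smult (transport_lla s \<phi> \<psi> T) = s"
  "bracket (transport_lla s \<phi> \<psi> T) x y = \<phi> (bracket T (\<psi> x) (\<psi> y))"
  "layer (transport_lla s \<phi> \<psi> T) i = \<phi> ` layer T i"
  by (simp_all add: transport_lla_def)

text \<open>\<open>\<psi>\<close> inverts \<open>\<phi>\<close> only on the carrier, since the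
  ambient space may be too large to embed in the target.\<close>

lemma (in lla) transport:
  fixes \<phi> :: "'a \<Rightarrow> 'b::ab_group_add"
  assumes "Vector_Spaces.linear (smult L) s \<phi>"
    and inv: "\<And>x. x \<in> carrier L \<Longrightarrow> \<psi> (\<phi> x) = x"
  shows "is_lla c (transport_lla s \<phi> \<psi> L)"
    and "lla_hom L (transport_lla s \<phi> \<psi> L) \<phi>"
    and "lla_hom (transport_lla s \<phi> \<psi> L) L \<psi>"
proof -
  let ?T = "transport_lla s \<phi> \<psi> L"
  interpret \<phi>: Vector_Spaces.linear "smult L" s \<phi> by fact
  have inv_layer: "\<psi> (\<phi> x) = x" if "x \<in> layer L i" "i \<ge> 1" for x i
    using inv layer_carrier that by blast
  show "is_lla c ?T"
  proof (rule is_llaI)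
    show "vector_space (smult ?T)" by (simp add: \<phi>.vs2.vector_space_axioms)
    show "module.subspace (smult ?T) (layer ?T i)" if "i \<ge> 1" for i
      using that by (auto intro: \<phi>.subspace_image subspace_layer)
    show "layer ?T (Suc i) \<subseteq> layer ?T i" if "i \<ge> 1" for i
      using that layer_decreasing[of i "Suc i"] by auto
    show "layer ?T i = {0}" if "i > c" for i
      using that layer_above by (simp add: \<phi>.zero)
    show "bracket ?T x y \<in> layer ?T (i + j)"
      if "i \<ge> 1" "j \<ge> 1" "x \<in> layer ?T i" "y \<in> layer ?T j" for i j x y
      using that bracket_layer by (auto simp: inv_layer)
    show "bracket ?T x y = - bracket ?T y x" if "x \<in> carrier ?T" "y \<in> carrier ?T" for x y
    proof -
      obtain u v where "x = \<phi> u" "u \<in> carrier L" "y = \<phi> v" "v \<in> carrier L"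
        using \<open>x \<in> carrier ?T\<close> \<open>y \<in> carrier ?T\<close> by auto
      thus ?thesis
        using bracket_anti[of u v] by (simp add: inv \<phi>.neg)
    qed
    show "bracket ?T x (bracket ?T y z) + bracket ?T y (bracket ?T z x)
        + bracket ?T z (bracket ?T x y) = 0"
      if "x \<in> carrier ?T" "y \<in> carrier ?T" "z \<in> carrier ?T" for x y z
      using that by (auto simp: inv jacobi \<phi>.zero simp flip: \<phi>.add)
  qed (auto simp: inv \<phi>.zero simp flip: \<phi>.add \<phi>.scale)
  show "lla_hom L ?T \<phi>"
    by (rule lla_homI) (auto simp: inv \<phi>.add \<phi>.scale)
  show "lla_hom ?T L \<psi>"
    by (rule lla_homI) (auto simp: inv inv_layer simp flip: \<phi>.add \<phi>.scale)
qed

lemma lla_hom_restrict: "lla_hom A B f \<Longrightarrow> lla_hom (induced_lla A D) B f"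
  unfolding lla_hom_def image_subset_iff by simp

text \<open>A cocone under A and B glued along A \<inter> B. The base of the amalgam is thus always
  the intersection and is no separate parameter.\<close>

definition compatible_homs ::
    "nat \<Rightarrow> ('f::field, 'a::ab_group_add) lla \<Rightarrow> 'a set \<Rightarrow> 'a set \<Rightarrow>
     ('f, 't::ab_group_add) lla \<Rightarrow> ('a \<Rightarrow> 't) \<Rightarrow> ('a \<Rightarrow> 't) \<Rightarrow> bool"
  where "compatible_homs c L A B T f g \<longleftrightarrow>
    is_lla c T \<and> lla_hom (induced_lla L A) T f \<and> lla_hom (induced_lla L B) T g \<and>
    (\<forall>x\<in>A \<inter> B. f x = g x)"

lemma carrier_induced: "sub_lla L A \<Longrightarrow> carrier (induced_lla L A) = A"
  using sub_lla_carrier[of L A] by auto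

text \<open>Only the sub-LLA generated by the two images matters. It is spanned by brackets of words
  over these images, so its size is bounded by words over A + B and it has a copy in the test
  universe; \<open>\<psi>\<close> maps the copy back into T.\<close>

lemma compatible_homs_factor:
  fixes L :: "('f::field, 'a::ab_group_add) lla" and T :: "('f, 't::ab_group_add) lla"
  assumes L: "sub_lla L A" "sub_lla L B"
    and fg: "compatible_homs c L A B T f g"
  obtains T' :: "('f, ('f, 'a) test_universe) lla" and f' g' \<psi>
    where "compatible_homs c L A B T' f' g'" "smult T' = pm_scale" "lla_hom T' T \<psi>"
      "\<And>x. x \<in> A \<Longrightarrow> \<psi> (f' x) = f x" "\<And>x. x \<in> B \<Longrightarrow> \<psi> (g' x) = g x"
proof -
  note fg' = fg[unfolded compatible_homs_def]
  interpret T: lla c T by unfold_locales (use fg' in simp)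
  define Z where "Z = f ` A \<union> g ` B"
  have f_carrier: "f x \<in> carrier T" if "x \<in> A" for x
    using that fg' lla_hom_layer[of _ T f 1 x] carrier_induced[OF L(1)] by auto
  have g_carrier: "g x \<in> carrier T" if "x \<in> B" for x
    using that fg' lla_hom_layer[of _ T g 1 x] carrier_induced[OF L(2)] by auto
  have Z: "Z \<subseteq> carrier T"
    using f_carrier g_carrier by (auto simp: Z_def)
  define G where "G = generated_lla T Z"
  have G: "sub_lla T G" unfolding G_def using Z by (rule T.sub_lla_generated)
  \<comment> \<open>Left letters are read through f, right ones through g. Letters outside A and B
    are harmless, as only an inclusion in the range is needed.\<close>
  define letter where "letter = case_sum f g"
  have "rbracket T ` lists Z \<subseteq> range (\<lambda>w. rbracket T (map letter w))"
  proof
    fix y assume "y \<in> rbracket T ` lists Z"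
    then obtain w where w: "set w \<subseteq> Z" "y = rbracket T w" by auto
    have "Z \<subseteq> letter ` UNIV" 
      unfolding Z_def letter_def by (force simp: image_iff intro: exI[of _ "Inl _"] exI[of _ "Inr _"])
    hence "w \<in> lists (letter ` UNIV)" using w by auto
    thus "y \<in> range (\<lambda>w. rbracket T (map letter w))"
      using w(2) unfolding lists_image by auto
  qed
  then obtain \<phi> :: "'t \<Rightarrow> ('f, 'a) test_universe"
    where \<phi>: "Vector_Spaces.linear (smult T) pm_scale \<phi>" "inj_on \<phi> (T.span (rbracket T ` lists Z))"
    by (rule T.embed_span_into_poly_mapping)
  have inj: "inj_on \<phi> G"
    using \<phi>(2) T.generated_subset_span_rbracket[OF Z] unfolding G_def by (rule inj_on_subset)
  define \<psi> where "\<psi> = inv_into G \<phi>"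
  interpret TG: lla c "induced_lla T G"
    by unfold_locales (rule T.is_lla_induced[OF G])
  define T' where "T' = transport_lla pm_scale \<phi> \<psi> (induced_lla T G)"
  have T': "is_lla c T'" "lla_hom (induced_lla T G) T' \<phi>" "lla_hom T' (induced_lla T G) \<psi>"
    unfolding T'_def by (rule TG.transport; use \<phi>(1) inj in \<open>simp add: \<psi>_def\<close>)+
  have fG: "f x \<in> G" if "x \<in> A" for x
    using that generated_incl[of Z T] by (auto simp: Z_def G_def)
  have gG: "g x \<in> G" if "x \<in> B" for x
    using that generated_incl[of Z T] by (auto simp: Z_def G_def)
  show ?thesis
  proof (rule that)
    have "lla_hom (induced_lla L A) (induced_lla T G) f"
      using fg' fG by (auto simp: lla_hom_into_induced)
    moreover have "lla_hom (induced_lla L B) (induced_lla T G) g"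
      using fg' gG by (auto simp: lla_hom_into_induced)
    ultimately show "compatible_homs c L A B T' (\<lambda>x. \<phi> (f x)) (\<lambda>x. \<phi> (g x))"
      using fg' T' unfolding compatible_homs_def by (auto intro: lla_hom_compose)
    show "smult T' = pm_scale" by (simp add: T'_def)
    show "lla_hom T' T \<psi>"
      using T'(3) by (simp add: lla_hom_into_induced)
    show "\<psi> (\<phi> (f x)) = f x" if "x \<in> A" for x
      using inj fG[OF that] by (simp add: \<psi>_def)
    show "\<psi> (\<phi> (g x)) = g x" if "x \<in> B" for x
      using inj gG[OF that] by (simp add: \<psi>_def)
  qed
qed

section \<open>The universal amalgam\<close>

text \<open>Functions on the whole index type, forced to be 0 outside \<open>I\<close> by every
  layer. One scalar multiplication serves all coordinates, so that the full function space is a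
  vector space, also at indices outside \<open>I\<close>.\<close>

definition product_lla ::
    "('f \<Rightarrow> 'w \<Rightarrow> 'w) \<Rightarrow> 'i set \<Rightarrow> ('i \<Rightarrow> ('f, 'w::zero) lla) \<Rightarrow> ('f, 'i \<Rightarrow> 'w) lla"
  where "product_lla s I T =
    \<lparr>smult = \<lambda>r x i. s r (x i),
     bracket = \<lambda>x y i. if i \<in> I then bracket (T i) (x i) (y i) else 0,
     layer = \<lambda>j. {x. \<forall>i. x i \<in> (if i \<in> I then layer (T i) j else {0})}\<rparr>"

lemma product_simps [simp]:
  "smult (product_lla s I T) = (\<lambda>r x i. s r (x i))"
  "bracket (product_lla s I T) = (\<lambda>x y i. if i \<in> I then bracket (T i) (x i) (y i) else 0)"
  "layer (product_lla s I T) j = {x. \<forall>i. x i \<in> (if i \<in> I then layer (T i) j else {0})}"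
  by (simp_all add: product_lla_def)

lemma vector_space_pointwise:
  assumes "vector_space s"
  shows "vector_space (\<lambda>r x i. s r (x i))"
proof -
  interpret vector_space s by fact
  show ?thesis
    by unfold_locales (auto simp: fun_eq_iff scale_right_distrib scale_left_distrib)
qed

lemma is_lla_product:
  fixes T :: "'i \<Rightarrow> ('f::field, 'w::ab_group_add) lla"
  assumes s: "vector_space s"
    and T: "\<And>i. i \<in> I \<Longrightarrow> is_lla c (T i)" "\<And>i. i \<in> I \<Longrightarrow> smult (T i) = s"
  shows "is_lla c (product_lla s I T)" (is "is_lla c ?P")
proof (rule is_llaI)
  interpret s: vector_space s by fact
  have lla: "lla c (T i)" if "i \<in> I" for i
    using T(1)[OF that] by unfold_locales
  show vs: "vector_space (smult ?P)"
    using vector_space_pointwise[OF s] by simp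
  interpret P: vector_space "smult ?P" by (rule vs)
  have 0: "s.subspace {0}" by (simp add: s.subspace_def)
  show "P.subspace (layer ?P j)" if "j \<ge> 1" for j
  proof -
    have "s.subspace (if i \<in> I then layer (T i) j else {0})" for i
      using lla.subspace_layer[OF lla that] T(2) 0 by auto
    hence "s.subspace (X i)" if "X = (\<lambda>i. if i \<in> I then layer (T i) j else {0})" for X i
      using that by simp
    thus ?thesis
      unfolding P.subspace_def by (simp add: s.subspace_def)
  qed
  show "layer ?P (Suc j) \<subseteq> layer ?P j" if "j \<ge> 1" for j
    using lla.layer_decreasing[OF lla that, of _ "Suc j"] by (auto split: if_splits)
  show "layer ?P j = {0}" if "j > c" for j
    using lla.layer_above[OF lla that] by (auto simp: fun_eq_iff)
  have comp: "x i \<in> layer (T i) j" if "x \<in> layer ?P j" "i \<in> I" for x i j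
    using that by (auto dest: spec[of _ i])
  show "bracket ?P x y \<in> layer ?P (j + k)"
    if "j \<ge> 1" "k \<ge> 1" "x \<in> layer ?P j" "y \<in> layer ?P k" for j k x y
    using that(1,2) lla.bracket_layer[OF lla] comp[OF that(3)] comp[OF that(4)] by simp
  show "bracket ?P (x + y) z = bracket ?P x z + bracket ?P y z"
    if "x \<in> carrier ?P" "y \<in> carrier ?P" "z \<in> carrier ?P" for x y z
    using lla.bracket_add_left[OF lla] that[THEN comp] by (simp add: fun_eq_iff)
  show "bracket ?P (smult ?P r x) y = smult ?P r (bracket ?P x y)"
    if "x \<in> carrier ?P" "y \<in> carrier ?P" for r x y
    using lla.bracket_scale_left[OF lla] that[THEN comp] T(2) by (simp add: fun_eq_iff)
  show "bracket ?P x x = 0" if "x \<in> carrier ?P" for x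
    using lla.bracket_self[OF lla] that[THEN comp] by (simp add: fun_eq_iff)
  show "bracket ?P x y = - bracket ?P y x" if "x \<in> carrier ?P" "y \<in> carrier ?P" for x y
  proof
    fix i show "bracket ?P x y i = (- bracket ?P y x) i"
      using lla.bracket_anti[OF lla, of i "x i" "y i"] that[THEN comp] by simp
  qed
  show "bracket ?P x (bracket ?P y z) + bracket ?P y (bracket ?P z x)
      + bracket ?P z (bracket ?P x y) = 0"
    if "x \<in> carrier ?P" "y \<in> carrier ?P" "z \<in> carrier ?P" for x y z
    using lla.jacobi[OF lla] that[THEN comp] by (simp add: fun_eq_iff)
qed

lemma lla_hom_into_product:
  assumes "\<And>i. i \<in> I \<Longrightarrow> lla_hom A (T i) (f i)" "\<And>i. i \<in> I \<Longrightarrow> smult (T i) = s"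
    and "vector_space s"
  shows "lla_hom A (product_lla s I T) (\<lambda>x i. if i \<in> I then f i x else 0)"
proof -
  interpret vector_space s by fact
  show ?thesis
  proof (rule lla_homI)
    show "(\<lambda>i. if i \<in> I then f i x else 0) \<in> layer (product_lla s I T) j"
      if "j \<ge> 1" "x \<in> layer A j" for j x
      using lla_hom_layer[OF assms(1) that] by simp
  qed (use assms(1,2) in \<open>auto simp: fun_eq_iff lla_hom_def\<close>)
qed

lemma lla_hom_projection:
  assumes "i \<in> I" "smult (T i) = s"
  shows "lla_hom (product_lla s I T) (T i) (\<lambda>x. x i)"
proof (rule lla_homI)
  show "x i \<in> layer (T i) j" if "x \<in> layer (product_lla s I T) j" for j x
    using that assms(1) by (auto dest: spec[of _ i])
qed (use assms in auto)

type_synonym ('f, 'a) amalgam_universe =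
  "('f, ('f, 'a) test_universe) lla \<times> ('a \<Rightarrow> ('f, 'a) test_universe) \<times>
    ('a \<Rightarrow> ('f, 'a) test_universe) \<Rightarrow> ('f, 'a) test_universe"

text \<open>
  The universal amalgam is the subalgebra of the product of all test algebras \<open>T\<close>, one factor for
  each compatible pair \<open>(f, g)\<close> into \<open>T\<close>, that is generated by the diagonal images of \<open>A\<close> and \<open>B\<close>.
\<close>

lemma universal_amalgam_exists:
  fixes L :: "('f::field, 'a::ab_group_add) lla"
  assumes L: "is_lla c L" "sub_lla L A" "sub_lla L B"
  obtains U :: "('f, ('f, 'a) amalgam_universe) lla"
    and F G
  where "compatible_homs c L A B U F G"
    and "generated_lla U (F ` A \<union> G ` B) = carrier U"
    and "\<And>(T :: ('f, ('f, 'a) test_universe) lla) f g.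
      compatible_homs c L A B T f g \<Longrightarrow> smult T = pm_scale \<Longrightarrow>
      \<exists>h. lla_hom U T h \<and> (\<forall>x\<in>A. h (F x) = f x) \<and> (\<forall>x\<in>B. h (G x) = g x)"
proof -
  define I where "I = {(T :: ('f, ('f, 'a) test_universe) lla, f, g).
    compatible_homs c L A B T f g \<and> smult T = pm_scale}"
  have I: "is_lla c (fst i)" "smult (fst i) = pm_scale"
    "lla_hom (induced_lla L A) (fst i) (fst (snd i))" "lla_hom (induced_lla L B) (fst i) (snd (snd i))"
    if "i \<in> I" for i
    using that by (auto simp: I_def compatible_homs_def)
  have I_eq: "fst (snd i) x = snd (snd i) x" if "i \<in> I" "x \<in> A \<inter> B" for i x
    using that by (auto simp: I_def compatible_homs_def)
  define P where "P = product_lla pm_scale I fst"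
  have "is_lla c P"
    unfolding P_def using I by (intro is_lla_product vector_space_pm_scale) auto
  then interpret P: lla c P by unfold_locales
  define F where "F x i = (if i \<in> I then fst (snd i) x else 0)" for x i
  define G where "G x i = (if i \<in> I then snd (snd i) x else 0)" for x i
  have F: "lla_hom (induced_lla L A) P F"
    unfolding F_def[abs_def] P_def using I by (intro lla_hom_into_product vector_space_pm_scale) auto
  have G: "lla_hom (induced_lla L B) P G"
    unfolding G_def[abs_def] P_def using I by (intro lla_hom_into_product vector_space_pm_scale) auto
  define Z where "Z = F ` A \<union> G ` B"
  have Z: "Z \<subseteq> carrier P"
    using lla_hom_layer[OF F, of 1] lla_hom_layer[OF G, of 1] L(2,3)[THEN carrier_induced]
    by (auto simp: Z_def)
  define V where "V = generated_lla P Z"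
  have V: "sub_lla P V" and ZV: "Z \<subseteq> V"
    using P.sub_lla_generated[OF Z] generated_incl[of Z P] by (simp_all add: V_def)
  show ?thesis
  proof (rule that)
    have "F x = G x" if "x \<in> A \<inter> B" for x
      using I_eq that by (auto simp: F_def G_def fun_eq_iff)
    thus "compatible_homs c L A B (induced_lla P V) F G"
      using F G ZV P.is_lla_induced[OF V]
      by (auto simp: compatible_homs_def lla_hom_into_induced Z_def)
    show "generated_lla (induced_lla P V) (F ` A \<union> G ` B) = carrier (induced_lla P V)"
      using P.generated_induced[OF ZV V] carrier_induced[OF V] by (simp add: V_def Z_def)
    fix T :: "('f, ('f, 'a) test_universe) lla" and f g
    assume T: "compatible_homs c L A B T f g" "smult T = pm_scale"
    hence i: "(T, f, g) \<in> I" by (simp add: I_def)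
    \<comment> \<open>The homomorphism required for (T, f, g) is the projection to the factor
      indexed by this very triple.\<close>
    have "lla_hom (product_lla pm_scale I fst) T (\<lambda>x. x (T, f, g))"
      using lla_hom_projection[of "(T, f, g)" I fst pm_scale] i T(2) by simp
    hence "lla_hom (induced_lla P V) T (\<lambda>x. x (T, f, g))"
      unfolding P_def by (rule lla_hom_restrict)
    thus "\<exists>h. lla_hom (induced_lla P V) T h \<and> (\<forall>x\<in>A. h (F x) = f x) \<and> (\<forall>x\<in>B. h (G x) = g x)"
      using i by (intro exI[of _ "\<lambda>x. x (T, f, g)"]) (auto simp: F_def G_def)
  qed
qed

text \<open>The existence half of the universal property of the amalgam over A \<inter> B;
  uniqueness is automatic because A and B generate.\<close>

definition amalgam_extension ::
    "'t::ab_group_add itself \<Rightarrow> nat \<Rightarrow> ('f::field, 'a::ab_group_add) lla \<Rightarrow> 'a set \<Rightarrow> 'a set \<Rightarrow> bool"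
  where "amalgam_extension _ c L A B \<longleftrightarrow>
    (\<forall>(T :: ('f, 't) lla) f g. compatible_homs c L A B T f g \<longrightarrow>
      (\<exists>h. lla_hom (induced_lla L (generated_lla L (A \<union> B))) T h \<and>
        (\<forall>x\<in>A. h x = f x) \<and> (\<forall>x\<in>B. h x = g x)))"

text \<open>An arbitrary test pair factors through a copy in the test universe; solve the problem
  there and compose with the map back.\<close>

lemma amalgam_extensionI:
  fixes L :: "('f::field, 'a::ab_group_add) lla"
  assumes L: "sub_lla L A" "sub_lla L B"
    and test: "\<And>(T :: ('f, ('f, 'a) test_universe) lla) f g.
      compatible_homs c L A B T f g \<Longrightarrow> smult T = pm_scale \<Longrightarrow>
      \<exists>h. lla_hom (induced_lla L (generated_lla L (A \<union> B))) T h \<and>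
        (\<forall>x\<in>A. h x = f x) \<and> (\<forall>x\<in>B. h x = g x)"
  shows "amalgam_extension TYPE('t::ab_group_add) c L A B"
  unfolding amalgam_extension_def
proof (intro allI impI)
  fix T :: "('f, 't) lla" and f g
  assume "compatible_homs c L A B T f g"
  then obtain T' :: "('f, ('f, 'a) test_universe) lla" and f' g' \<psi>
    where T': "compatible_homs c L A B T' f' g'" "smult T' = pm_scale" "lla_hom T' T \<psi>"
      "\<And>x. x \<in> A \<Longrightarrow> \<psi> (f' x) = f x" "\<And>x. x \<in> B \<Longrightarrow> \<psi> (g' x) = g x"
    using compatible_homs_factor[OF L] by blast
  obtain h where h: "lla_hom (induced_lla L (generated_lla L (A \<union> B))) T' h"
      "\<forall>x\<in>A. h x = f' x" "\<forall>x\<in>B. h x = g' x"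
    using test[OF T'(1,2)] by blast
  show "\<exists>h. lla_hom (induced_lla L (generated_lla L (A \<union> B))) T h \<and>
      (\<forall>x\<in>A. h x = f x) \<and> (\<forall>x\<in>B. h x = g x)"
    using lla_hom_compose[OF h(1) T'(3)] h(2,3) T'(4,5)
    by (intro exI[of _ "\<lambda>x. \<psi> (h x)"]) auto
qed

text \<open>The same reduction for maps out of the universal amalgam. It is needed because the dual
  numbers over U live outside the test universe.\<close>

lemma universal_amalgam_any_type:
  fixes U :: "('f::field, 'u::ab_group_add) lla" and L :: "('f, 'a::ab_group_add) lla"
    and T :: "('f, 't::ab_group_add) lla"
  assumes L: "sub_lla L A" "sub_lla L B"
    and test: "\<And>(T :: ('f, ('f, 'a) test_universe) lla) f g.
      compatible_homs c L A B T f g \<Longrightarrow> smult T = pm_scale \<Longrightarrow>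
      \<exists>h. lla_hom U T h \<and> (\<forall>x\<in>A. h (F x) = f x) \<and> (\<forall>x\<in>B. h (G x) = g x)"
    and T: "compatible_homs c L A B T f g"
  obtains h where "lla_hom U T h" "\<And>x. x \<in> A \<Longrightarrow> h (F x) = f x" "\<And>x. x \<in> B \<Longrightarrow> h (G x) = g x"
proof -
  obtain T' :: "('f, ('f, 'a) test_universe) lla" and f' g' \<psi>
    where T': "compatible_homs c L A B T' f' g'" "smult T' = pm_scale" "lla_hom T' T \<psi>"
      "\<And>x. x \<in> A \<Longrightarrow> \<psi> (f' x) = f x" "\<And>x. x \<in> B \<Longrightarrow> \<psi> (g' x) = g x"
    using compatible_homs_factor[OF L T] by blast
  obtain h where h: "lla_hom U T' h" "\<forall>x\<in>A. h (F x) = f' x" "\<forall>x\<in>B. h (G x) = g' x"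
    using test[OF T'(1,2)] by blast
  show ?thesis
    using lla_hom_compose[OF h(1) T'(3)] h(2,3) T'(4,5) that[of "\<lambda>x. \<psi> (h x)"] by simp
qed

section \<open>Derivations\<close>

definition derivation :: "('f::field, 'a::ab_group_add) lla \<Rightarrow> ('a \<Rightarrow> 'a) \<Rightarrow> bool"
  where "derivation L q \<longleftrightarrow>
    (\<forall>x\<in>carrier L. q x \<in> carrier L) \<and>
    (\<forall>x\<in>carrier L. \<forall>y\<in>carrier L. q (x + y) = q x + q y) \<and>
    (\<forall>r. \<forall>x\<in>carrier L. q (smult L r x) = smult L r (q x)) \<and>
    (\<forall>x\<in>carrier L. \<forall>y\<in>carrier L. q (bracket L x y) = bracket L (q x) y + bracket L x (q y))"

context lla
begin

lemma derivation_zero: "derivation L q \<Longrightarrow> q 0 = 0"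
  by (metis derivation_def add_cancel_right_right add_0 zero_carrier)

text \<open>The kernel of a derivation is a sub-LLA.\<close>

lemma derivation_vanishes:
  assumes "derivation L q" "X \<subseteq> carrier L" "\<And>x. x \<in> X \<Longrightarrow> q x = 0"
    and "x \<in> generated_lla L X"
  shows "q x = 0"
proof -
  have "sub_lla L {x \<in> carrier L. q x = 0}"
    using assms(1) derivation_zero[OF assms(1)]
    by (auto simp: derivation_def sub_lla_def subspace_def)
  hence "generated_lla L X \<subseteq> {x \<in> carrier L. q x = 0}"
    using assms(2,3) by (intro generated_minimal) auto
  thus ?thesis using assms(4) by auto
qed

lemma derivation_diff:
  "derivation L p \<Longrightarrow> derivation L q \<Longrightarrow> derivation L (\<lambda>x. p x - q x)"
  by (simp add: derivation_def scale_right_diff_distrib)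

lemma derivation_add:
  "derivation L p \<Longrightarrow> derivation L q \<Longrightarrow> derivation L (\<lambda>x. p x + q x)"
  by (simp add: derivation_def scale_right_distrib)

lemma derivation_scale: "derivation L p \<Longrightarrow> derivation L (\<lambda>x. smult L r (p x))"
  by (simp add: derivation_def scale_right_distrib mult.commute)

lemma derivation_inner: "u \<in> carrier L \<Longrightarrow> derivation L (bracket L u)"
  by (simp add: derivation_def bracket_bracket_right[of u])

lemma derivation_commutator:
  "derivation L p \<Longrightarrow> derivation L q \<Longrightarrow> derivation L (\<lambda>x. p (q x) - q (p x))"
  by (simp add: derivation_def scale_right_diff_distrib)

end

text \<open>
  A derivation of \<open>U\<close> raising layers by \<open>i\<close> is a section over \<open>U\<close> of the algebra of dual numbers
  with the series shifted by \<open>i\<close> on the nilpotent part.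
\<close>

definition dual_lla :: "nat \<Rightarrow> ('f, 'u::plus) lla \<Rightarrow> ('f, 'u \<times> 'u) lla"
  where "dual_lla i U =
    \<lparr>smult = \<lambda>r x. (smult U r (fst x), smult U r (snd x)),
     bracket = \<lambda>x y. (bracket U (fst x) (fst y), bracket U (fst x) (snd y) + bracket U (snd x) (fst y)),
     layer = \<lambda>j. layer U j \<times> layer U (i + j)\<rparr>"

lemma dual_simps [simp]:
  "smult (dual_lla i U) r x = (smult U r (fst x), smult U r (snd x))"
  "bracket (dual_lla i U) x y =
    (bracket U (fst x) (fst y), bracket U (fst x) (snd y) + bracket U (snd x) (fst y))"
  "layer (dual_lla i U) j = layer U j \<times> layer U (i + j)"
  by (simp_all add: dual_lla_def)

lemma vector_space_pair_scale:
  assumes "vector_space s" "vector_space t"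
  shows "vector_space (\<lambda>r x. (s r (fst x), t r (snd x)))"
proof -
  interpret s: vector_space s by fact
  interpret t: vector_space t by fact
  show ?thesis
    by unfold_locales
      (simp_all add: prod_eq_iff s.scale_right_distrib s.scale_left_distrib
        t.scale_right_distrib t.scale_left_distrib)
qed

lemma (in lla) is_lla_dual: "is_lla c (dual_lla i L)"
proof (rule is_llaI)
  have sc: "smult (dual_lla i L) = (\<lambda>r x. (smult L r (fst x), smult L r (snd x)))"
    by (simp add: fun_eq_iff)
  show vs: "vector_space (smult (dual_lla i L))"
    unfolding sc by (intro vector_space_pair_scale vector_space_axioms)
  interpret P: vector_space "smult (dual_lla i L)" by (rule vs)
  have snd_carrier: "x \<in> carrier L" if "x \<in> layer L (i + j)" "j \<ge> 1" for x j
    using that layer_carrier[of "i + j" x] by simp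
  show "P.subspace (layer (dual_lla i L) j)" if "j \<ge> 1" for j
    using subspace_layer[OF that] subspace_layer[of "i + j"] that
    unfolding P.subspace_def by (auto simp: subspace_def zero_prod_def)
  show "layer (dual_lla i L) (Suc j) \<subseteq> layer (dual_lla i L) j" if "j \<ge> 1" for j
    using layer_decreasing[of j "Suc j"] layer_decreasing[of "i + j" "i + Suc j"] that by auto
  show "layer (dual_lla i L) j = {0}" if "j > c" for j
    using layer_above[of j] layer_above[of "i + j"] that by (auto simp: zero_prod_def)
  show "bracket (dual_lla i L) x y \<in> layer (dual_lla i L) (j + k)"
    if "j \<ge> 1" "k \<ge> 1" "x \<in> layer (dual_lla i L) j" "y \<in> layer (dual_lla i L) k" for j k x y
  proof -
    have "bracket L (fst x) (fst y) \<in> layer L (j + k)"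
      and "bracket L (fst x) (snd y) \<in> layer L (i + (j + k))"
      and "bracket L (snd x) (fst y) \<in> layer L (i + (j + k))"
      using that bracket_layer[of j k] bracket_layer[of j "i + k"] bracket_layer[of "i + j" k]
      by (auto simp: mem_Times_iff add.left_commute add.assoc)
    thus ?thesis
      using subspace_add[OF subspace_layer[of "i + (j + k)"]] that by simp
  qed
  show "bracket (dual_lla i L) x y = - bracket (dual_lla i L) y x"
    if "x \<in> carrier (dual_lla i L)" "y \<in> carrier (dual_lla i L)" for x y
    using that snd_carrier[of _ 1] bracket_anti[of "fst x" "fst y"] bracket_anti[of "fst x" "snd y"]
      bracket_anti[of "snd x" "fst y"] by (simp add: mem_Times_iff)
  show "bracket (dual_lla i L) x (bracket (dual_lla i L) y z) +
      bracket (dual_lla i L) y (bracket (dual_lla i L) z x) +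
      bracket (dual_lla i L) z (bracket (dual_lla i L) x y) = 0"
    if "x \<in> carrier (dual_lla i L)" "y \<in> carrier (dual_lla i L)" "z \<in> carrier (dual_lla i L)" for x y z
  proof -
    have c: "fst x \<in> carrier L" "fst y \<in> carrier L" "fst z \<in> carrier L"
      "snd x \<in> carrier L" "snd y \<in> carrier L" "snd z \<in> carrier L"
      using that snd_carrier[of _ 1] by (auto simp: mem_Times_iff)
    \<comment> \<open>The second coordinate is the sum of three Jacobi identities, each with one
      argument replaced by its nilpotent part.\<close>
    show ?thesis
      using jacobi[OF c(1) c(2) c(3)] c
        arg_cong2[where f = "(+)", OF arg_cong2[where f = "(+)",
          OF jacobi[OF c(4) c(2) c(3)] jacobi[OF c(1) c(5) c(3)]] jacobi[OF c(1) c(2) c(6)]]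
      by (simp add: prod_eq_iff algebra_simps)
  qed
  show "bracket (dual_lla i L) x x = 0" if "x \<in> carrier (dual_lla i L)" for x
    using that snd_carrier[of _ 1] bracket_anti[of "fst x" "snd x"]
    by (simp add: mem_Times_iff zero_prod_def)
  show "bracket (dual_lla i L) (x + y) z = bracket (dual_lla i L) x z + bracket (dual_lla i L) y z"
    if "x \<in> carrier (dual_lla i L)" "y \<in> carrier (dual_lla i L)" "z \<in> carrier (dual_lla i L)" for x y z
    using that snd_carrier[of _ 1] by (simp add: mem_Times_iff)
  show "bracket (dual_lla i L) (smult (dual_lla i L) r x) y =
      smult (dual_lla i L) r (bracket (dual_lla i L) x y)"
    if "x \<in> carrier (dual_lla i L)" "y \<in> carrier (dual_lla i L)" for r x y
    using that snd_carrier[of _ 1] by (simp add: mem_Times_iff scale_right_distrib)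
qed

section \<open>Extending an LLA by derivations\<close>

text \<open>An extension of the abelian Lie algebra \<open>D\<close> by \<open>U\<close>, with
  action \<open>\<delta>\<close> and factor set \<open>\<beta>\<close>: all brackets fall into
  \<open>U\<close>. Elements of \<open>D\<close> count up to layer \<open>i\<close> and no
  deeper.\<close>

definition derivation_extension_lla ::
    "nat \<Rightarrow> ('f, 'u::ab_group_add) lla \<Rightarrow> ('f \<Rightarrow> 'a::ab_group_add \<Rightarrow> 'a) \<Rightarrow> 'a set \<Rightarrow>
     ('a \<Rightarrow> 'u \<Rightarrow> 'u) \<Rightarrow> ('a \<Rightarrow> 'a \<Rightarrow> 'u) \<Rightarrow> ('f, 'u \<times> 'a) lla"
  where "derivation_extension_lla i U s D \<delta> \<beta> =
    \<lparr>smult = \<lambda>r x. (smult U r (fst x), s r (snd x)),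
     bracket = \<lambda>x y. (bracket U (fst x) (fst y) + \<delta> (snd x) (fst y) - \<delta> (snd y) (fst x)
       + \<beta> (snd x) (snd y), 0),
     layer = \<lambda>j. layer U j \<times> (if j \<le> i then D else {0})\<rparr>"

lemma derivation_extension_simps [simp]:
  "smult (derivation_extension_lla i U s D \<delta> \<beta>) r x = (smult U r (fst x), s r (snd x))"
  "bracket (derivation_extension_lla i U s D \<delta> \<beta>) x y =
    (bracket U (fst x) (fst y) + \<delta> (snd x) (fst y) - \<delta> (snd y) (fst x) + \<beta> (snd x) (snd y), 0)"
  "layer (derivation_extension_lla i U s D \<delta> \<beta>) j = layer U j \<times> (if j \<le> i then D else {0})"
  by (simp_all add: derivation_extension_lla_def)

text \<open>\<open>\<delta>_commutator\<close> and \<open>\<beta>_cocycle\<close> are the identities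
  of a factor set: the Jacobi identity demands them for two and for three arguments from
  \<open>D\<close>. The other conditions make \<open>\<delta>\<close> and \<open>\<beta>\<close>
  bilinear, let \<open>D\<close> act by derivations and give it weight \<open>i\<close>.\<close>

locale derivation_extension = U: lla c U + L: lla c L
  for c :: nat and U :: "('f::field, 'u::ab_group_add) lla" and L :: "('f, 'a::ab_group_add) lla" +
  fixes i :: nat and D :: "'a set" and \<delta> :: "'a \<Rightarrow> 'u \<Rightarrow> 'u" and \<beta> :: "'a \<Rightarrow> 'a \<Rightarrow> 'u"
  assumes i: "1 \<le> i" "i \<le> c"
    and D: "L.subspace D" "D \<subseteq> layer L i"
    and \<delta>_derivation: "d \<in> D \<Longrightarrow> derivation U (\<delta> d)"
    and \<delta>_layer: "d \<in> D \<Longrightarrow> j \<ge> 1 \<Longrightarrow> u \<in> layer U j \<Longrightarrow> \<delta> d u \<in> layer U (i + j)"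
    and \<delta>_add_left: "d \<in> D \<Longrightarrow> e \<in> D \<Longrightarrow> u \<in> carrier U \<Longrightarrow> \<delta> (d + e) u = \<delta> d u + \<delta> e u"
    and \<delta>_scale_left: "d \<in> D \<Longrightarrow> u \<in> carrier U \<Longrightarrow> \<delta> (smult L r d) u = smult U r (\<delta> d u)"
    and \<beta>_layer: "d \<in> D \<Longrightarrow> e \<in> D \<Longrightarrow> \<beta> d e \<in> layer U (i + i)"
    and \<beta>_add: "d \<in> D \<Longrightarrow> d' \<in> D \<Longrightarrow> e \<in> D \<Longrightarrow> \<beta> (d + d') e = \<beta> d e + \<beta> d' e"
    and \<beta>_scale: "d \<in> D \<Longrightarrow> e \<in> D \<Longrightarrow> \<beta> (smult L r d) e = smult U r (\<beta> d e)"
    and \<beta>_self: "d \<in> D \<Longrightarrow> \<beta> d d = 0"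
    and \<beta>_anti: "d \<in> D \<Longrightarrow> e \<in> D \<Longrightarrow> \<beta> d e = - \<beta> e d"
    and \<delta>_commutator: "d \<in> D \<Longrightarrow> e \<in> D \<Longrightarrow> u \<in> carrier U \<Longrightarrow>
      \<delta> d (\<delta> e u) - \<delta> e (\<delta> d u) = bracket U (\<beta> d e) u"
    and \<beta>_cocycle: "d \<in> D \<Longrightarrow> e \<in> D \<Longrightarrow> f \<in> D \<Longrightarrow>
      \<delta> d (\<beta> e f) + \<delta> e (\<beta> f d) + \<delta> f (\<beta> d e) = 0"
begin

abbreviation Ext :: "('f, 'u \<times> 'a) lla"
  where "Ext \<equiv> derivation_extension_lla i U (smult L) D \<delta> \<beta>"

lemma \<delta>_carrier: "d \<in> D \<Longrightarrow> u \<in> carrier U \<Longrightarrow> \<delta> d u \<in> carrier U"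
  and \<delta>_add: "d \<in> D \<Longrightarrow> u \<in> carrier U \<Longrightarrow> v \<in> carrier U \<Longrightarrow> \<delta> d (u + v) = \<delta> d u + \<delta> d v"
  and \<delta>_scale: "d \<in> D \<Longrightarrow> u \<in> carrier U \<Longrightarrow> \<delta> d (smult U r u) = smult U r (\<delta> d u)"
  and \<delta>_bracket: "d \<in> D \<Longrightarrow> u \<in> carrier U \<Longrightarrow> v \<in> carrier U \<Longrightarrow>
    \<delta> d (bracket U u v) = bracket U (\<delta> d u) v + bracket U u (\<delta> d v)"
  using \<delta>_derivation[of d] by (simp_all add: derivation_def)

lemma \<delta>_minus: "d \<in> D \<Longrightarrow> u \<in> carrier U \<Longrightarrow> \<delta> d (- u) = - \<delta> d u"
  using \<delta>_scale[of d u "- 1"] by (simp add: U.scale_minus_left)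

lemma \<delta>_diff: "d \<in> D \<Longrightarrow> u \<in> carrier U \<Longrightarrow> v \<in> carrier U \<Longrightarrow> \<delta> d (u - v) = \<delta> d u - \<delta> d v"
  using \<delta>_add[of d u "- v"] by (simp add: \<delta>_minus)

lemma zero_D: "0 \<in> D"
  using D(1) by (rule L.subspace_0)

lemma \<delta>_zero_left: "u \<in> carrier U \<Longrightarrow> \<delta> 0 u = 0"
  using \<delta>_scale_left[of 0 u 0] zero_D by simp

lemma \<beta>_zero_left: "d \<in> D \<Longrightarrow> \<beta> 0 d = 0"
  using \<beta>_scale[of 0 d 0] zero_D by simp

lemma \<beta>_zero_right: "d \<in> D \<Longrightarrow> \<beta> d 0 = 0"
  using \<beta>_anti[of d 0] \<beta>_zero_left zero_D by simp

lemma \<beta>_carrier: "d \<in> D \<Longrightarrow> e \<in> D \<Longrightarrow> \<beta> d e \<in> carrier U"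
  using \<beta>_layer[of d e] U.layer_carrier[of "i + i" "\<beta> d e"] i by simp

lemma carrier_Ext: "carrier Ext = carrier U \<times> D"
  using i by simp

lemmas D_ops = L.subspace_add[OF D(1)] L.subspace_scale[OF D(1)] L.subspace_neg[OF D(1)]
  L.subspace_diff[OF D(1)]

lemma bracket_\<beta>_right:
  assumes "d \<in> D" "e \<in> D" "u \<in> carrier U"
  shows "bracket U u (\<beta> d e) = \<delta> e (\<delta> d u) - \<delta> d (\<delta> e u)"
proof -
  have "bracket U u (\<beta> d e) = - bracket U (\<beta> d e) u"
    using assms by (intro U.bracket_anti \<beta>_carrier)
  thus ?thesis
    using \<delta>_commutator[OF assms, symmetric] by simp
qed

lemma Ext_jacobi:
  assumes "x \<in> carrier Ext" "y \<in> carrier Ext" "z \<in> carrier Ext"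
  shows "bracket Ext x (bracket Ext y z) + bracket Ext y (bracket Ext z x) +
    bracket Ext z (bracket Ext x y) = 0"
proof -
  obtain u d v e w f where xyz: "x = (u, d)" "y = (v, e)" "z = (w, f)"
    by (metis surj_pair)
  hence u: "u \<in> carrier U" and v: "v \<in> carrier U" and w: "w \<in> carrier U"
    and d: "d \<in> D" and e: "e \<in> D" and f: "f \<in> D"
    using assms unfolding carrier_Ext by auto
  \<comment> \<open>The first coordinate of one Jacobi term, with all brackets oriented alike. In
    the cyclic sum every mixed term cancels, which leaves the Jacobi identity of \<open>U\<close>
    and the cocycle identity.\<close>
  have expand: "bracket U u (bracket U v w + \<delta> e w - \<delta> f v + \<beta> e f) +
      \<delta> d (bracket U v w + \<delta> e w - \<delta> f v + \<beta> e f) =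
    bracket U u (bracket U v w) + bracket U u (\<delta> e w) - bracket U u (\<delta> f v)
      + (\<delta> f (\<delta> e u) - \<delta> e (\<delta> f u)) + (- bracket U w (\<delta> d v) + bracket U v (\<delta> d w))
      + \<delta> d (\<delta> e w) - \<delta> d (\<delta> f v) + \<delta> d (\<beta> e f)"
    if "u \<in> carrier U" "v \<in> carrier U" "w \<in> carrier U" "d \<in> D" "e \<in> D" "f \<in> D"
    for u v w d e f
  proof -
    have "bracket U (\<delta> d v) w = - bracket U w (\<delta> d v)"
      using that by (intro U.bracket_anti \<delta>_carrier)
    thus ?thesis
      using that by (simp add: \<delta>_carrier \<beta>_carrier \<delta>_add \<delta>_diff \<delta>_bracket bracket_\<beta>_right)
  qed
  have "bracket Ext x (bracket Ext y z) + bracket Ext y (bracket Ext z x) +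
      bracket Ext z (bracket Ext x y) =
    (bracket U u (bracket U v w) + bracket U v (bracket U w u) + bracket U w (bracket U u v)
      + (\<delta> d (\<beta> e f) + \<delta> e (\<beta> f d) + \<delta> f (\<beta> d e)), 0)"
    using expand[OF u v w d e f] expand[OF v w u e f d] expand[OF w u v f d e]
    using u v w d e f
    by (simp add: xyz \<beta>_zero_right \<delta>_zero_left)
  thus ?thesis
    using U.jacobi[OF u v w] \<beta>_cocycle[OF d e f] by (simp add: zero_prod_def)
qed

lemma is_lla_Ext: "is_lla c Ext"
proof (rule is_llaI)
  have sc: "smult Ext = (\<lambda>r x. (smult U r (fst x), smult L r (snd x)))"
    by (simp add: fun_eq_iff)
  show vs: "vector_space (smult Ext)"
    unfolding sc by (intro vector_space_pair_scale U.vector_space_axioms L.vector_space_axioms)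
  interpret P: vector_space "smult Ext" by (rule vs)
  show "P.subspace (layer Ext j)" if "j \<ge> 1" for j
    using U.subspace_layer[OF that] D(1)
    unfolding P.subspace_def by (auto simp: L.subspace_def U.subspace_def zero_prod_def)
  show "layer Ext (Suc j) \<subseteq> layer Ext j" if "j \<ge> 1" for j
    using U.layer_decreasing[of j "Suc j"] that zero_D by auto
  show "layer Ext j = {0}" if "j > c" for j
    using U.layer_above[of j] that i by (auto simp: zero_prod_def)
  show "bracket Ext x y \<in> layer Ext (j + k)"
    if jk: "j \<ge> 1" "k \<ge> 1" and x: "x \<in> layer Ext j" and y: "y \<in> layer Ext k" for j k x y
  proof -
    obtain u d v e where xy: "x = (u, d)" "y = (v, e)"
      by (metis surj_pair)
    have u: "u \<in> layer U j" "d \<in> D" "d \<noteq> 0 \<Longrightarrow> j \<le> i"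
      and v: "v \<in> layer U k" "e \<in> D" "e \<noteq> 0 \<Longrightarrow> k \<le> i"
      using x y zero_D by (auto simp: xy split: if_splits)
    have P: "U.subspace (layer U (j + k))"
      using jk by (intro U.subspace_layer) simp
    \<comment> \<open>If d \<noteq> 0, then membership in layer j forces j \<le> i, so raising
      layers by i also raises them by j. The case d = 0 contributes 0. The same split serves the
      next two terms.\<close>
    have dv: "\<delta> d v \<in> layer U (j + k)"
    proof (cases "d = 0")
      case True
      thus ?thesis using v jk U.layer_carrier U.subspace_0[OF P] by (auto simp: \<delta>_zero_left)
    next
      case False
      thus ?thesis
        using \<delta>_layer[OF u(2) jk(2) v(1)] U.layer_decreasing[of "j + k" "i + k"] u(3) jk by auto
    qed
    have eu: "\<delta> e u \<in> layer U (j + k)"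
    proof (cases "e = 0")
      case True
      thus ?thesis using u jk U.layer_carrier U.subspace_0[OF P] by (auto simp: \<delta>_zero_left)
    next
      case False
      thus ?thesis
        using \<delta>_layer[OF v(2) jk(1) u(1)] U.layer_decreasing[of "j + k" "i + j"] v(3) jk by auto
    qed
    have "\<beta> d e \<in> layer U (j + k)"
    proof (cases "d = 0 \<or> e = 0")
      case True
      thus ?thesis using u v U.subspace_0[OF P] \<beta>_zero_left \<beta>_zero_right by auto
    next
      case False
      thus ?thesis
        using \<beta>_layer[OF u(2) v(2)] U.layer_decreasing[of "j + k" "i + i"] u(3) v(3) jk by auto
    qed
    thus ?thesis
      using dv eu U.bracket_layer[OF jk u(1) v(1)] U.subspace_add[OF P] U.subspace_diff[OF P] zero_D
      by (simp add: xy)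
  qed
  show "bracket Ext x x = 0" if "x \<in> carrier Ext" for x
    using that by (auto simp: carrier_Ext \<beta>_self zero_prod_def simp del: derivation_extension_simps(3))
  show "bracket Ext x y = - bracket Ext y x" if "x \<in> carrier Ext" "y \<in> carrier Ext" for x y
    using that U.bracket_anti[of "fst x" "fst y"] \<beta>_anti[of "snd x" "snd y"]
    by (auto simp: carrier_Ext mem_Times_iff simp del: derivation_extension_simps(3))
  show "bracket Ext (x + y) z = bracket Ext x z + bracket Ext y z"
    if "x \<in> carrier Ext" "y \<in> carrier Ext" "z \<in> carrier Ext" for x y z
    using that by (simp add: carrier_Ext mem_Times_iff \<delta>_add \<delta>_add_left \<beta>_add
        del: derivation_extension_simps(3))
  show "bracket Ext (smult Ext r x) y = smult Ext r (bracket Ext x y)"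
    if "x \<in> carrier Ext" "y \<in> carrier Ext" for r x y
    using that by (simp add: carrier_Ext mem_Times_iff \<delta>_scale \<delta>_scale_left \<beta>_scale
        U.scale_right_distrib U.scale_right_diff_distrib del: derivation_extension_simps(3))
qed (rule Ext_jacobi)

end

section \<open>Splitting off a complement\<close>

text \<open>The projection to D along A, meaningful only on A + D with A \<inter> D = {0}.\<close>

definition component :: "'a::ab_group_add set \<Rightarrow> 'a set \<Rightarrow> 'a \<Rightarrow> 'a"
  where "component A D x = (THE d. d \<in> D \<and> x - d \<in> A)"

lemma (in module) component_eq:
  assumes "subspace A" "subspace D" "A \<inter> D = {0}" "d \<in> D" "x - d \<in> A"
  shows "component A D x = d"
  unfolding component_def
proof (rule the_equality)
  fix e assume e: "e \<in> D \<and> x - e \<in> A"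
  have "(x - d) - (x - e) \<in> A"
    using subspace_diff[OF assms(1,5)] e by blast
  moreover have "e - d \<in> D"
    using subspace_diff[OF assms(2)] assms(4) e by blast
  ultimately have "e - d \<in> A \<inter> D" by simp
  thus "e = d" using assms(3) by simp
qed (use assms(4,5) in simp)

text \<open>The complement is the part of V killed by a linear retraction onto W.\<close>

lemma (in vector_space) subspace_complement:
  assumes V: "subspace V" and W: "subspace W" "W \<subseteq> V"
  obtains D where "subspace D" "D \<subseteq> V" "W \<inter> D = {0}" "\<And>x. x \<in> V \<Longrightarrow> \<exists>d\<in>D. x - d \<in> W"
proof -
  interpret vector_space_pair scale scale by unfold_locales
  obtain g where g: "range g \<subseteq> W" "Vector_Spaces.linear scale scale g" "\<And>v. v \<in> W \<Longrightarrow> g v = v"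
    using linear_exists_left_inverse_on[OF linear_id W(1)] by auto
  interpret g: Vector_Spaces.linear scale scale g by (rule g(2))
  show ?thesis
  proof (rule that)
    show "subspace {v \<in> V. g v = 0}"
      using V by (simp add: subspace_def g.zero g.add g.scale)
    show "W \<inter> {v \<in> V. g v = 0} = {0}"
      using g(3) subspace_0[OF V] subspace_0[OF W(1)] g.zero by force
    show "\<exists>d\<in>{v \<in> V. g v = 0}. x - d \<in> W" if "x \<in> V" for x
    proof
      have gx: "g x \<in> W" using g(1) by auto
      show "x - (x - g x) \<in> W" using gx by simp
      show "x - g x \<in> {v \<in> V. g v = 0}"
        using gx W(2) subspace_diff[OF V that] g(3)[OF gx] by (auto simp: g.diff)
    qed
  qed auto
qed

text \<open>On the direct sum A' = A + D the map sends u + d to (F u, d). By \<open>deep\<close>,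
  brackets of D with A' fall into A, so all brackets of A' lie in A, just as those of the extension
  lie in \<open>U\<close>.\<close>

lemma (in derivation_extension) hom_extension:
  assumes A: "sub_lla L A" "sub_lla L A'" "A \<subseteq> A'" "D \<subseteq> A'" "A \<inter> D = {0}"
    and split: "\<And>x. x \<in> A' \<Longrightarrow> \<exists>d\<in>D. x - d \<in> A"
    and deep: "A' \<inter> layer L (i + 1) \<subseteq> A"
    and F: "lla_hom (induced_lla L A) U F"
    and \<delta>F: "\<And>d x. d \<in> D \<Longrightarrow> x \<in> A \<Longrightarrow> \<delta> d (F x) = F (bracket L d x)"
    and \<beta>F: "\<And>d e. d \<in> D \<Longrightarrow> e \<in> D \<Longrightarrow> \<beta> d e = F (bracket L d e)"
  shows "lla_hom (induced_lla L A') Ext (\<lambda>x. (F (x - component A D x), component A D x))"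
proof -
  interpret A: lla c "induced_lla L A"
    by unfold_locales (rule L.is_lla_induced[OF A(1)])
  interpret F: lla_homomorphism c "induced_lla L A" U F
    by unfold_locales (rule F)
  define p where "p = component A D"
  have A_sub: "L.subspace A" using A(1) by (rule L.sub_lla_subspace)
  have A_carrier: "x \<in> carrier L" if "x \<in> A" for x
    using that A(1) sub_lla_carrier by blast
  have D_layer: "d \<in> layer L j" if "d \<in> D" "1 \<le> j" "j \<le> i" for d j
    using that D(2) L.layer_decreasing[of j i] by auto
  have D_carrier: "d \<in> carrier L" if "d \<in> D" for d
    using that D_layer[of d 1] i by simp
  have p_eq: "p x = d" if "d \<in> D" "x - d \<in> A" for x d
    unfolding p_def using A_sub D(1) A(5) that by (rule L.component_eq)
  have p: "p x \<in> D" "x - p x \<in> A" if "x \<in> A'" for x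
    using split[OF that] p_eq by auto
  have F_add: "F (x + y) = F x + F y" if "x \<in> A" "y \<in> A" for x y
    using F.map_add that A_carrier by simp
  have F_diff: "F (x - y) = F x - F y" if "x \<in> A" "y \<in> A" for x y
    using F.map_diff that A_carrier by simp
  have F_scale: "F (smult L r x) = smult U r (F x)" if "x \<in> A" for r x
    using F.map_scale that A_carrier by simp
  have F_bracket: "F (bracket L x y) = bracket U (F x) (F y)" if "x \<in> A" "y \<in> A" for x y
    using F.map_bracket that A_carrier by simp
  have DA: "bracket L d x \<in> A" if "d \<in> D" "x \<in> A'" for d x
  proof -
    have "x \<in> carrier L" using that A(2) sub_lla_carrier by blast
    hence "bracket L d x \<in> layer L (i + 1)"
      using that D_layer[of d i] i by (intro L.bracket_layer) auto
    moreover have "bracket L d x \<in> A'"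
      using that A by (intro L.sub_lla_bracket[OF A(2)]) auto
    ultimately show ?thesis using deep by auto
  qed
  have "lla_hom (induced_lla L A') Ext (\<lambda>x. (F (x - p x), p x))"
  proof (rule lla_homI; unfold induced_simps)
    fix x y assume "x \<in> carrier L \<inter> A'" "y \<in> carrier L \<inter> A'"
    hence x: "x \<in> A'" and y: "y \<in> A'" by auto
    have "p (x + y) = p x + p y"
      by (rule p_eq) (use p[OF x] p[OF y] D_ops L.subspace_add[OF A_sub p(2)[OF x] p(2)[OF y]]
          in \<open>simp_all add: algebra_simps\<close>)
    thus "(F (x + y - p (x + y)), p (x + y)) = (F (x - p x), p x) + (F (y - p y), p y)"
      using F_add[OF p(2)[OF x] p(2)[OF y]] by (simp add: algebra_simps)
    define u where "u = x - p x"
    define v where "v = y - p y"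
    have uv: "u \<in> A" "v \<in> A" "p x \<in> D" "p y \<in> D"
      using p x y by (simp_all add: u_def v_def)
    have xy: "x = u + p x" "y = v + p y" by (simp_all add: u_def v_def)
    have uv': "u \<in> A'" "v \<in> A'" "p x \<in> A'" "p y \<in> A'" using uv A by auto
    have in_A: "bracket L u v \<in> A" "bracket L (p x) v \<in> A" "bracket L (p y) u \<in> A"
      "bracket L (p x) (p y) \<in> A"
      using uv uv' DA L.sub_lla_bracket[OF A(1)] by auto
    have "bracket L u (p y) = - bracket L (p y) u"
      using uv A_carrier D_carrier by (intro L.bracket_anti) auto
    hence b: "bracket L x y = bracket L u v + bracket L (p x) v - bracket L (p y) u
        + bracket L (p x) (p y)"
      using uv A_carrier D_carrier by (subst xy(1), subst xy(2)) simp
    have bA: "bracket L x y \<in> A"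
      unfolding b using in_A by (intro L.subspace_add[OF A_sub] L.subspace_diff[OF A_sub])
    have "p (bracket L x y) = 0"
      by (rule p_eq) (use bA zero_D in simp_all)
    moreover have "F (bracket L x y) = bracket U (F u) (F v) + \<delta> (p x) (F v) - \<delta> (p y) (F u)
        + \<beta> (p x) (p y)"
      unfolding b using uv in_A L.subspace_add[OF A_sub] L.subspace_diff[OF A_sub]
      by (simp add: F_add F_diff F_bracket \<delta>F \<beta>F)
    ultimately show "(F (bracket L x y - p (bracket L x y)), p (bracket L x y)) =
        bracket Ext (F (x - p x), p x) (F (y - p y), p y)"
      by (simp add: u_def v_def)
  next
    fix r x assume "x \<in> carrier L \<inter> A'"
    hence x: "x \<in> A'" by auto
    have "p (smult L r x) = smult L r (p x)"
      by (rule p_eq) (use p[OF x] D_ops L.subspace_scale[OF A_sub p(2)[OF x], of r]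
          in \<open>simp_all add: L.scale_right_diff_distrib\<close>)
    thus "(F (smult L r x - p (smult L r x)), p (smult L r x)) = smult Ext r (F (x - p x), p x)"
      using F_scale[OF p(2)[OF x], of r] by (simp add: L.scale_right_diff_distrib)
  next
    fix j :: nat and x assume j: "j \<ge> 1" and "x \<in> layer L j \<inter> A'"
    hence x: "x \<in> A'" "x \<in> layer L j" by auto
    show "(F (x - p x), p x) \<in> layer Ext j"
    \<comment> \<open>Up to layer i, subtracting the D-component stays in the layer; beyond it,
      \<open>deep\<close> makes the component 0.\<close>
    proof (cases "j \<le> i")
      case True
      have "x - p x \<in> layer L j"
        using x p D_layer[OF p(1)[OF x(1)] j True] by (intro L.subspace_diff[OF L.subspace_layer[OF j]])
      thus ?thesis
        using F.map_layer[OF j, of "x - p x"] p[OF x(1)] True by simp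
    next
      case False
      hence xA: "x \<in> A" using deep x L.layer_decreasing[of "i + 1" j] by auto
      have "p x = 0" by (rule p_eq) (use xA zero_D in simp_all)
      thus ?thesis using F.map_layer[OF j, of x] xA x False by simp
    qed
  qed
  thus ?thesis by (simp add: p_def)
qed

text \<open>The first-order deformation of F along ad d: multiplicativity is the derivation rule for
  ad d, and the shifted series absorbs that ad d raises layers by i.\<close>

lemma (in lla) hom_into_dual:
  assumes A: "sub_lla L A" and d: "d \<in> layer L i" "i \<ge> 1" "\<And>x. x \<in> A \<Longrightarrow> bracket L d x \<in> A"
    and U: "is_lla c U" and F: "lla_hom (induced_lla L A) U F"
  shows "lla_hom (induced_lla L A) (dual_lla i U) (\<lambda>x. (F x, F (bracket L d x)))"
proof -
  interpret A: lla c "induced_lla L A"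
    by unfold_locales (rule is_lla_induced[OF A])
  interpret F: lla_homomorphism c "induced_lla L A" U F
    by unfold_locales (use U F in simp_all)
  have dc: "d \<in> carrier L" using d layer_carrier by blast
  show ?thesis
  proof (rule lla_homI; unfold induced_simps)
    fix x y assume xy: "x \<in> carrier L \<inter> A" "y \<in> carrier L \<inter> A"
    have mem: "bracket L d x \<in> carrier L \<inter> A" "bracket L d y \<in> carrier L \<inter> A"
      using xy dc d(3) by auto
    show "(F (x + y), F (bracket L d (x + y))) =
        (F x, F (bracket L d x)) + (F y, F (bracket L d y))"
      using xy mem dc F.map_add by simp
    have "bracket L (bracket L d x) y \<in> carrier L \<inter> A" "bracket L x (bracket L d y) \<in> carrier L \<inter> A"
      using xy mem sub_lla_bracket[OF A] by auto
    thus "(F (bracket L x y), F (bracket L d (bracket L x y))) =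
        bracket (dual_lla i U) (F x, F (bracket L d x)) (F y, F (bracket L d y))"
      using xy mem dc F.map_add F.map_bracket
      by (simp add: bracket_bracket_right[of d x y] add.commute)
  next
    fix r x assume x: "x \<in> carrier L \<inter> A"
    have "bracket L d x \<in> carrier L \<inter> A"
      using x dc d(3) by auto
    thus "(F (smult L r x), F (bracket L d (smult L r x))) =
        smult (dual_lla i U) r (F x, F (bracket L d x))"
      using x dc F.map_scale by simp
  next
    fix j x assume j: "j \<ge> (1::nat)" and x: "x \<in> layer L j \<inter> A"
    show "(F x, F (bracket L d x)) \<in> layer (dual_lla i U) j"
      using F.map_layer[OF j, of x] F.map_layer[of "i + j" "bracket L d x"] x j d(1,2)
        bracket_layer[OF d(2) j d(1), of x] d(3)[of x] by simp
  qed
qed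

lemma amalgam_extension_any_type:
  fixes L :: "('f::field, 'a::ab_group_add) lla"
  assumes "sub_lla L A" "sub_lla L B" "amalgam_extension TYPE(('f, 'a) test_universe) c L A B"
  shows "amalgam_extension TYPE('t::ab_group_add) c L A B"
  using assms(1,2) by (rule amalgam_extensionI) (use assms(3) in \<open>auto simp: amalgam_extension_def\<close>)

section \<open>The inductive step\<close>

text \<open>By \<open>meet\<close> both intersections equal A \<inter> B, so a single complement D,
  taken in layer i of A' \<inter> B', splits A' over A and B' over B. By \<open>deep\<close>, ad d
  for d in D maps A' into A and B' into B.\<close>

lemma amalgam_extension_step:
  fixes L :: "('f::field, 'a::ab_group_add) lla"
  assumes "is_lla c L" and i: "1 \<le> i" "i \<le> c"
    and A: "sub_lla L A" "sub_lla L A'" "A \<subseteq> A'"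
    and B: "sub_lla L B" "sub_lla L B'" "B \<subseteq> B'"
    and meet: "A \<inter> B' = A' \<inter> B"
    and split_A: "\<And>x. x \<in> A' \<Longrightarrow> \<exists>k\<in>layer L i \<inter> (A' \<inter> B'). x - k \<in> A"
    and split_B: "\<And>x. x \<in> B' \<Longrightarrow> \<exists>k\<in>layer L i \<inter> (A' \<inter> B'). x - k \<in> B"
    and deep: "A' \<inter> layer L (i + 1) \<subseteq> A" "B' \<inter> layer L (i + 1) \<subseteq> B"
    and ext: "amalgam_extension TYPE(('f, 'a) test_universe) c L A' B'"
  shows "amalgam_extension TYPE('t::ab_group_add) c L A B"
proof -
  interpret L: lla c L by unfold_locales fact

  \<comment> \<open>A common complement of A in A' and of B in B'\<close>
  define K where "K = layer L i \<inter> (A' \<inter> B')"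
  have A_sub: "L.subspace A" and B_sub: "L.subspace B"
    using A B by (auto intro: L.sub_lla_subspace)
  have "L.subspace K"
    unfolding K_def using i A B L.sub_lla_subspace by (intro L.subspace_inter L.subspace_layer)
  moreover have "L.subspace (A \<inter> B \<inter> K)"
    using \<open>L.subspace K\<close> A_sub B_sub by (intro L.subspace_inter)
  ultimately obtain D where D: "L.subspace D" "D \<subseteq> K" "A \<inter> B \<inter> K \<inter> D = {0}"
    and split_K: "\<And>x. x \<in> K \<Longrightarrow> \<exists>d\<in>D. x - d \<in> A \<inter> B \<inter> K"
    by (rule L.subspace_complement) auto
  have D_layer: "D \<subseteq> layer L i" and DA': "D \<subseteq> A'" and DB': "D \<subseteq> B'"
    using D(2) by (auto simp: K_def)
  \<comment> \<open>D lies in A' and in B', so by \<open>meet\<close> an element of D in one of A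
    and B lies in the other as well.\<close>
  have AD: "A \<inter> D = {0}" and BD: "B \<inter> D = {0}"
  proof -
    have "A \<inter> D \<subseteq> A \<inter> B \<inter> K \<inter> D" "B \<inter> D \<subseteq> A \<inter> B \<inter> K \<inter> D"
      using meet D(2) DA' DB' by auto
    moreover have "0 \<in> A" "0 \<in> B" "0 \<in> D"
      using A_sub B_sub D(1) L.subspace_0 by auto
    ultimately show "A \<inter> D = {0}" "B \<inter> D = {0}" using D(3) by auto
  qed
  \<comment> \<open>Replace k by its D-component: the difference lies in A \<inter> B and is
    absorbed by X.\<close>
  have split_D: "\<exists>d\<in>D. x - d \<in> X"
    if X: "L.subspace X" "A \<inter> B \<subseteq> X" and x: "\<exists>k\<in>K. x - k \<in> X" for X x
  proof -
    obtain k where k: "k \<in> K" "x - k \<in> X" using x by blast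
    obtain d where d: "d \<in> D" "k - d \<in> A \<inter> B" using split_K[OF k(1)] by auto
    have "(x - k) + (k - d) \<in> X"
      using k d X by (intro L.subspace_add[OF X(1)]) auto
    thus ?thesis using d by auto
  qed
  have split_AD: "\<exists>d\<in>D. x - d \<in> A" if "x \<in> A'" for x
    using split_D[OF A_sub _ split_A[OF that, folded K_def]] by auto
  have split_BD: "\<exists>d\<in>D. x - d \<in> B" if "x \<in> B'" for x
    using split_D[OF B_sub _ split_B[OF that, folded K_def]] by auto
  have in_carrier: "x \<in> carrier L" if "x \<in> A' \<or> x \<in> B'" for x
    using that A B sub_lla_carrier by blast
  have D_carrier: "d \<in> carrier L" if "d \<in> D" for d
    using that DA' in_carrier by auto
  have DA: "bracket L d x \<in> A" if "d \<in> D" "x \<in> A'" for d x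
  proof -
    have "bracket L d x \<in> layer L (i + 1)"
      using that D_layer i in_carrier by (intro L.bracket_layer) auto
    moreover have "bracket L d x \<in> A'"
      using that DA' by (intro L.sub_lla_bracket[OF A(2)]) auto
    ultimately show ?thesis using deep by blast
  qed
  have DB: "bracket L d x \<in> B" if "d \<in> D" "x \<in> B'" for d x
  proof -
    have "bracket L d x \<in> layer L (i + 1)"
      using that D_layer i in_carrier by (intro L.bracket_layer) auto
    moreover have "bracket L d x \<in> B'"
      using that DB' by (intro L.sub_lla_bracket[OF B(2)]) auto
    ultimately show ?thesis using deep by blast
  qed
  have DD: "bracket L d e \<in> A \<inter> B" if "d \<in> D" "e \<in> D" for d e
    using DA[OF that(1), of e] DB[OF that(1), of e] that DA' DB' by auto

  \<comment> \<open>The universal amalgam of A and B\<close>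
  obtain U :: "('f, ('f, 'a) amalgam_universe) lla"
    and F G
    where FG: "compatible_homs c L A B U F G"
      and gen: "generated_lla U (F ` A \<union> G ` B) = carrier U"
      and univ: "\<And>(T :: ('f, ('f, 'a) test_universe) lla) f g.
        compatible_homs c L A B T f g \<Longrightarrow> smult T = pm_scale \<Longrightarrow>
        \<exists>h. lla_hom U T h \<and> (\<forall>x\<in>A. h (F x) = f x) \<and> (\<forall>x\<in>B. h (G x) = g x)"
    using universal_amalgam_exists[OF assms(1) A(1) B(1)] by blast
  note FG' = FG[unfolded compatible_homs_def]
  interpret U: lla c U by unfold_locales (use FG' in simp)
  interpret A: lla c "induced_lla L A"
    by unfold_locales (rule L.is_lla_induced[OF A(1)])
  interpret B: lla c "induced_lla L B"
    by unfold_locales (rule L.is_lla_induced[OF B(1)])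
  interpret F: lla_homomorphism c "induced_lla L A" U F
    by unfold_locales (use FG' in simp)
  interpret G: lla_homomorphism c "induced_lla L B" U G
    by unfold_locales (use FG' in simp)
  have cA: "carrier (induced_lla L A) = A" and cB: "carrier (induced_lla L B) = B"
    using A(1) B(1) by (simp_all only: carrier_induced)
  have F_carrier: "F x \<in> carrier U" if "x \<in> A" for x
    using F.map_carrier[of x] that unfolding cA .
  have G_carrier: "G x \<in> carrier U" if "x \<in> B" for x
    using G.map_carrier[of x] that unfolding cB .
  have F_add: "F (x + y) = F x + F y" if "x \<in> A" "y \<in> A" for x y
    using F.map_add[unfolded cA] that by simp
  have G_add: "G (x + y) = G x + G y" if "x \<in> B" "y \<in> B" for x y
    using G.map_add[unfolded cB] that by simp
  have F_diff: "F (x - y) = F x - F y" if "x \<in> A" "y \<in> A" for x y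
    using F.map_diff[unfolded cA] that by simp
  have G_diff: "G (x - y) = G x - G y" if "x \<in> B" "y \<in> B" for x y
    using G.map_diff[unfolded cB] that by simp
  have F_scale: "F (smult L r x) = smult U r (F x)" if "x \<in> A" for r x
    using F.map_scale[unfolded cA] that by simp
  have G_scale: "G (smult L r x) = smult U r (G x)" if "x \<in> B" for r x
    using G.map_scale[unfolded cB] that by simp
  have F_bracket: "F (bracket L x y) = bracket U (F x) (F y)" if "x \<in> A" "y \<in> A" for x y
    using F.map_bracket[unfolded cA] that by simp
  have G_bracket: "G (bracket L x y) = bracket U (G x) (G y)" if "x \<in> B" "y \<in> B" for x y
    using G.map_bracket[unfolded cB] that by simp
  have FG_eq: "F x = G x" if "x \<in> A" "x \<in> B" for x
    using FG' that by auto

  \<comment> \<open>The action of D on U by derivations\<close>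
  define acts where "acts d q \<longleftrightarrow>
      derivation U q \<and> (\<forall>j\<ge>1. \<forall>u\<in>layer U j. q u \<in> layer U (i + j)) \<and>
      (\<forall>x\<in>A. q (F x) = F (bracket L d x)) \<and> (\<forall>x\<in>B. q (G x) = G (bracket L d x))" for d q
  have "\<exists>q. acts d q" if d: "d \<in> D" for d
  proof -
    have d': "d \<in> layer L i" using d D_layer by auto
    have dual: "compatible_homs c L A B (dual_lla i U)
        (\<lambda>x. (F x, F (bracket L d x))) (\<lambda>x. (G x, G (bracket L d x)))"
      unfolding compatible_homs_def
    proof (intro conjI ballI)
      show "is_lla c (dual_lla i U)" by (rule U.is_lla_dual)
      show "lla_hom (induced_lla L A) (dual_lla i U) (\<lambda>x. (F x, F (bracket L d x)))"
        using DA[OF d] A(3) by (intro L.hom_into_dual[OF A(1) d' i(1) _ U.is_lla F.hom]) auto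
      show "lla_hom (induced_lla L B) (dual_lla i U) (\<lambda>x. (G x, G (bracket L d x)))"
        using DB[OF d] B(3) by (intro L.hom_into_dual[OF B(1) d' i(1) _ U.is_lla G.hom]) auto
      show "(F x, F (bracket L d x)) = (G x, G (bracket L d x))" if "x \<in> A \<inter> B" for x
      proof -
        have "x \<in> A" "x \<in> B" "x \<in> A'" "x \<in> B'"
          using that A(3) B(3) by auto
        thus ?thesis using DA[OF d, of x] DB[OF d, of x] FG_eq by simp
      qed
    qed
    obtain h where h: "lla_hom U (dual_lla i U) h"
        "\<And>x. x \<in> A \<Longrightarrow> h (F x) = (F x, F (bracket L d x))"
        "\<And>x. x \<in> B \<Longrightarrow> h (G x) = (G x, G (bracket L d x))"
      by (rule universal_amalgam_any_type[OF A(1) B(1) _ dual, where U = U and F = F and G = G])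
        (rule univ, assumption, assumption, blast)
    interpret dual: lla c "dual_lla i U" by unfold_locales (rule U.is_lla_dual)
    interpret h: lla_homomorphism c U "dual_lla i U" h by unfold_locales (rule h(1))
    \<comment> \<open>\<open>h\<close> is a section of the dual numbers: its first coordinate is an
      endomorphism of U fixing the generators. Hence its second coordinate is a derivation.\<close>
    have fst_h: "fst (h u) = u" if "u \<in> carrier U" for u
    proof (rule hom_eq_on_generated[where g = "\<lambda>u. u", OF U.is_lla U.is_lla])
      show "lla_hom U U (\<lambda>u. fst (h u))"
        using h.map_layer by (intro lla_homI) (auto simp: mem_Times_iff)
      show "u \<in> generated_lla U (F ` A \<union> G ` B)" using that gen by simp
      show "F ` A \<union> G ` B \<subseteq> carrier U" using F_carrier G_carrier by auto
      show "fst (h v) = v" if "v \<in> F ` A \<union> G ` B" for v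
        using that h(2,3) by auto
    qed (simp add: lla_hom_def)
    have h_layer: "snd (h u) \<in> layer U (i + j)" if "j \<ge> 1" "u \<in> layer U j" for j u
      using h.map_layer[OF that] by (auto simp: mem_Times_iff)
    have "derivation U (\<lambda>u. snd (h u))"
      unfolding derivation_def
      using h_layer[of 1] U.layer_carrier[of "i + 1"] by (simp add: fst_h add.commute)
    thus ?thesis
      using h_layer h(2,3) by (intro exI[of _ "\<lambda>u. snd (h u)"]) (simp add: acts_def)
  qed
  then obtain \<delta> where acts: "\<And>d. d \<in> D \<Longrightarrow> acts d (\<delta> d)"
    by metis
  have \<delta>: "\<And>d. d \<in> D \<Longrightarrow> derivation U (\<delta> d)"
    "\<And>d j u. d \<in> D \<Longrightarrow> j \<ge> 1 \<Longrightarrow> u \<in> layer U j \<Longrightarrow> \<delta> d u \<in> layer U (i + j)"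
    "\<And>d x. d \<in> D \<Longrightarrow> x \<in> A \<Longrightarrow> \<delta> d (F x) = F (bracket L d x)"
    "\<And>d x. d \<in> D \<Longrightarrow> x \<in> B \<Longrightarrow> \<delta> d (G x) = G (bracket L d x)"
    using acts by (simp_all add: acts_def)
  \<comment> \<open>A derivation of U is determined by its values on the images of A and B. So all
    identities among the chosen \<open>\<delta> d\<close>, linearity in d included, need checking on
    generators only.\<close>
  have vanish: "q u = 0"
    if "derivation U q" "\<And>x. x \<in> A \<Longrightarrow> q (F x) = 0" "\<And>x. x \<in> B \<Longrightarrow> q (G x) = 0" "u \<in> carrier U"
    for q u
    by (rule U.derivation_vanishes[OF that(1), of "F ` A \<union> G ` B"])
      (use that F_carrier G_carrier gen in auto)
  \<comment> \<open>The factor set is the bracket of D in L. It lands in A \<inter> B, so F and G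
    give the same value.\<close>
  define \<beta> where "\<beta> d e = F (bracket L d e)" for d e
  have \<beta>_G: "\<beta> d e = G (bracket L d e)" if "d \<in> D" "e \<in> D" for d e
    using DD[OF that] by (simp add: \<beta>_def FG_eq)
  have A_carrier: "x \<in> carrier L" if "x \<in> A" for x using that A(3) in_carrier by auto
  have B_carrier: "x \<in> carrier L" if "x \<in> B" for x using that B(3) in_carrier by auto
  have DA1: "bracket L d x \<in> A" if "d \<in> D" "x \<in> A" for d x using DA that A(3) by auto
  have DB1: "bracket L d x \<in> B" if "d \<in> D" "x \<in> B" for d x using DB that B(3) by auto
  have DD_A: "bracket L d e \<in> A" and DD_B: "bracket L d e \<in> B" if "d \<in> D" "e \<in> D" for d e
    using DD that by auto

  \<comment> \<open>The extension of U by D\<close>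
  interpret X: derivation_extension c U L i D \<delta> \<beta>
  proof
    show "1 \<le> i" "i \<le> c" "L.subspace D" "D \<subseteq> layer L i" by fact+
    show "derivation U (\<delta> d)" if "d \<in> D" for d using \<delta> that by blast
    show "\<delta> d u \<in> layer U (i + j)" if "d \<in> D" "j \<ge> 1" "u \<in> layer U j" for d j u
      using \<delta> that by blast
    show "\<delta> (d + e) u = \<delta> d u + \<delta> e u" if "d \<in> D" "e \<in> D" "u \<in> carrier U" for d e u
    proof -
      have de: "d + e \<in> D" using that D(1) L.subspace_add by blast
      have "\<delta> (d + e) u - (\<delta> d u + \<delta> e u) = 0"
        by (rule vanish[OF U.derivation_diff[OF \<delta>(1)[OF de]
                U.derivation_add[OF \<delta>(1)[OF that(1)] \<delta>(1)[OF that(2)]]] _ _ that(3)])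
          (use that de in \<open>simp_all add: \<delta> D_carrier A_carrier B_carrier F_add G_add DA1 DB1\<close>)
      thus ?thesis by simp
    qed
    show "\<delta> (smult L r d) u = smult U r (\<delta> d u)" if "d \<in> D" "u \<in> carrier U" for d r u
    proof -
      have rd: "smult L r d \<in> D" using that D(1) L.subspace_scale by blast
      have "\<delta> (smult L r d) u - smult U r (\<delta> d u) = 0"
        by (rule vanish[OF U.derivation_diff[OF \<delta>(1)[OF rd]
                U.derivation_scale[OF \<delta>(1)[OF that(1)]]] _ _ that(2)])
          (use that rd in \<open>simp_all add: \<delta> D_carrier A_carrier B_carrier F_scale G_scale DA1 DB1\<close>)
      thus ?thesis by simp
    qed
    show "\<beta> d e \<in> layer U (i + i)" if "d \<in> D" "e \<in> D" for d e
    proof -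
      have "bracket L d e \<in> layer L (i + i) \<inter> A"
        using that D_layer i DD_A by (auto intro: L.bracket_layer)
      thus ?thesis using F.map_layer[of "i + i" "bracket L d e"] i by (simp add: \<beta>_def)
    qed
    show "\<beta> (d + d') e = \<beta> d e + \<beta> d' e" if "d \<in> D" "d' \<in> D" "e \<in> D" for d d' e
      using that by (simp add: \<beta>_def D_carrier F_add DD_A)
    show "\<beta> (smult L r d) e = smult U r (\<beta> d e)" if "d \<in> D" "e \<in> D" for r d e
      using that by (simp add: \<beta>_def D_carrier F_scale DD_A)
    show "\<beta> d d = 0" if "d \<in> D" for d
      using that by (simp add: \<beta>_def D_carrier)
    show "\<beta> d e = - \<beta> e d" if "d \<in> D" "e \<in> D" for d e
    proof -
      have "bracket L d e = - bracket L e d"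
        using that D_carrier by (intro L.bracket_anti)
      thus ?thesis using F.map_minus[unfolded cA] DD_A[of e d] that by (simp add: \<beta>_def)
    qed
    show "\<delta> d (\<delta> e u) - \<delta> e (\<delta> d u) = bracket U (\<beta> d e) u"
      if "d \<in> D" "e \<in> D" "u \<in> carrier U" for d e u
    proof -
      have bc: "\<beta> d e \<in> carrier U"
        using that by (simp add: \<beta>_def F_carrier DD_A)
      \<comment> \<open>The commutator of \<open>\<delta> d\<close> and \<open>\<delta> e\<close>
        and the inner map of \<open>\<beta> d e\<close> are both derivations; on generators they
        agree by the Jacobi identity in L.\<close>
      have "\<delta> d (\<delta> e u) - \<delta> e (\<delta> d u) - bracket U (\<beta> d e) u = 0"
      proof (rule vanish[OF U.derivation_diff[OF U.derivation_commutator[OF \<delta>(1)[OF that(1)]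
                \<delta>(1)[OF that(2)]] U.derivation_inner[OF bc]] _ _ that(3)])
        fix x assume x: "x \<in> A"
        have "bracket U (\<beta> d e) (F x) = F (bracket L (bracket L d e) x)"
          using that x by (simp add: \<beta>_def F_bracket DD_A)
        thus "\<delta> d (\<delta> e (F x)) - \<delta> e (\<delta> d (F x)) - bracket U (\<beta> d e) (F x) = 0"
          using that x
          by (simp add: \<delta> DA1 L.bracket_bracket_left[of d e x] D_carrier A_carrier F_diff)
      next
        fix x assume x: "x \<in> B"
        have "bracket U (\<beta> d e) (G x) = G (bracket L (bracket L d e) x)"
          using that x by (simp add: \<beta>_G G_bracket DD_B)
        thus "\<delta> d (\<delta> e (G x)) - \<delta> e (\<delta> d (G x)) - bracket U (\<beta> d e) (G x) = 0"
          using that x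
          by (simp add: \<delta> DB1 L.bracket_bracket_left[of d e x] D_carrier B_carrier G_diff)
      qed
      thus ?thesis by simp
    qed
    show "\<delta> d (\<beta> e f) + \<delta> e (\<beta> f d) + \<delta> f (\<beta> d e) = 0"
      if "d \<in> D" "e \<in> D" "f \<in> D" for d e f
    proof -
      have "\<delta> d (\<beta> e f) + \<delta> e (\<beta> f d) + \<delta> f (\<beta> d e) =
        F (bracket L d (bracket L e f) + bracket L e (bracket L f d) + bracket L f (bracket L d e))"
        using that by (simp add: \<beta>_def \<delta> DD_A DA1 F_add L.subspace_add[OF A_sub])
      thus ?thesis using that by (simp add: L.jacobi D_carrier)
    qed
  qed

  \<comment> \<open>Mapping A' and B' to the extension\<close>
  define f where "f x = (F (x - component A D x), component A D x)" for x
  define g where "g x = (G (x - component B D x), component B D x)" for x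
  have fg: "compatible_homs c L A' B' X.Ext f g"
    unfolding compatible_homs_def
  proof (intro conjI ballI)
    show "is_lla c X.Ext" by (rule X.is_lla_Ext)
    show "lla_hom (induced_lla L A') X.Ext f"
      unfolding f_def[abs_def]
      by (rule X.hom_extension[OF A DA' AD split_AD deep(1) F.hom]) (simp_all add: \<delta> \<beta>_def)
    show "lla_hom (induced_lla L B') X.Ext g"
      unfolding g_def[abs_def]
      by (rule X.hom_extension[OF B DB' BD split_BD deep(2) G.hom]) (simp_all add: \<delta> \<beta>_G)
    \<comment> \<open>On the overlap, x - d lies in A and in B', hence by \<open>meet\<close> in B.
      So the components of x along A and along B coincide.\<close>
    fix x assume x: "x \<in> A' \<inter> B'"
    then obtain d where d: "d \<in> D" "x - d \<in> A" using split_AD by blast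
    have "x - d \<in> B'"
      using x d DB' L.subspace_diff[OF L.sub_lla_subspace[OF B(2)]] by auto
    hence B: "x - d \<in> B" using d meet by auto
    have "component A D x = d" "component B D x = d"
      using L.component_eq[OF A_sub D(1) AD d] L.component_eq[OF B_sub D(1) BD d(1) B] by simp_all
    thus "f x = g x"
      using d B by (simp add: f_def g_def FG_eq)
  qed

  \<comment> \<open>Restriction to the sub-LLA generated by A and B\<close>
  interpret Ext: lla c X.Ext by unfold_locales (rule X.is_lla_Ext)
  define S where "S = generated_lla L (A \<union> B)"
  define S' where "S' = generated_lla L (A' \<union> B')"
  \<comment> \<open>The extension lives outside the test universe, so freeness of A' and B' is first
    carried over to its type.\<close>
  have "amalgam_extension TYPE(('f, 'a) amalgam_universe \<times> 'a) c L A' B'"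
    by (rule amalgam_extension_any_type[OF A(2) B(2) ext])
  then obtain h where h: "lla_hom (induced_lla L S') X.Ext h"
      "\<And>x. x \<in> A' \<Longrightarrow> h x = f x" "\<And>x. x \<in> B' \<Longrightarrow> h x = g x"
    using fg unfolding amalgam_extension_def S'_def by blast
  have S: "sub_lla L S" and AB_S: "A \<subseteq> S" "B \<subseteq> S"
    using A B in_carrier generated_incl[of "A \<union> B" L] unfolding S_def
    by (auto intro!: L.sub_lla_generated)
  have "S \<subseteq> S'"
    unfolding S_def S'_def using A(3) B(3) by (intro generated_mono) auto
  hence h_S: "lla_hom (induced_lla L S) X.Ext h"
    using lla_hom_restrict[OF h(1), of S] by (simp add: induced_lla_def Int_absorb1 inf_assoc)
  interpret S: lla c "induced_lla L S" by unfold_locales (rule L.is_lla_induced[OF S])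
  interpret h: lla_homomorphism c "induced_lla L S" X.Ext h by unfold_locales (rule h_S)
  have cS: "carrier (induced_lla L S) = S" by (rule carrier_induced[OF S])
  have comp0: "component A D x = 0" if "x \<in> A" for x
    using that X.zero_D by (intro L.component_eq[OF A_sub D(1) AD]) auto
  have comp0': "component B D x = 0" if "x \<in> B" for x
    using that X.zero_D by (intro L.component_eq[OF B_sub D(1) BD]) auto
  have h_A: "h x = (F x, 0)" if "x \<in> A" for x
    using that h(2)[of x] A(3) comp0 by (auto simp: f_def)
  have h_B: "h x = (G x, 0)" if "x \<in> B" for x
    using that h(3)[of x] B(3) comp0' by (auto simp: g_def)
  \<comment> \<open>The elements with second coordinate 0 form a sub-LLA of the extension, and it
    contains the images of A and B, hence that of S.\<close>
  have snd_h: "snd (h x) = 0" if "x \<in> S" for x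
  proof -
    have "sub_lla X.Ext {t \<in> carrier X.Ext. snd t = 0}"
      unfolding sub_lla_def X.carrier_Ext Ext.subspace_def using X.zero_D
      by (auto simp: X.\<delta>_zero_left X.\<beta>_zero_left zero_prod_def)
    moreover have AB: "A \<union> B \<subseteq> carrier (induced_lla L S)"
      unfolding cS using AB_S by auto
    moreover have "x \<in> generated_lla (induced_lla L S) (A \<union> B)"
      using that L.generated_induced[of "A \<union> B" S] AB_S S by (simp add: S_def)
    moreover have "h ` (A \<union> B) \<subseteq> {t \<in> carrier X.Ext. snd t = 0}"
      unfolding X.carrier_Ext using F_carrier G_carrier X.zero_D h_A h_B by auto
    ultimately have "h x \<in> {t \<in> carrier X.Ext. snd t = 0}"
      by (intro h.map_generated[OF AB])
    thus ?thesis by simp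
  qed
  have h_carrier: "fst (h x) \<in> carrier U" if "x \<in> S" for x
    using h.map_carrier[unfolded cS, OF that] unfolding X.carrier_Ext by auto
  \<comment> \<open>With second coordinates 0 the \<open>\<delta>\<close> and \<open>\<beta>\<close>
    terms vanish, so the first coordinate is a homomorphism from S to U that extends F and G. Every
    test pair on A and B then extends along S to U to T.\<close>
  define k where "k x = fst (h x)" for x
  have k: "lla_hom (induced_lla L S) U k"
  proof (rule lla_homI, unfold cS)
    fix x y assume xy: "x \<in> S" "y \<in> S"
    show "k (x + y) = k x + k y"
      using h.map_add[unfolded cS, OF xy] by (simp add: k_def)
    show "k (bracket (induced_lla L S) x y) = bracket U (k x) (k y)"
      using h.map_bracket[unfolded cS, OF xy] xy snd_h h_carrier X.zero_D
      by (simp add: k_def X.\<delta>_zero_left X.\<beta>_zero_left)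
  next
    show "k (smult (induced_lla L S) r x) = smult U r (k x)" if "x \<in> S" for r x
      using h.map_scale[unfolded cS, OF that] by (simp add: k_def)
    show "k x \<in> layer U j" if "j \<ge> 1" "x \<in> layer (induced_lla L S) j" for j x
      using h.map_layer[OF that] by (auto simp: k_def mem_Times_iff)
  qed
  show ?thesis
  proof (rule amalgam_extensionI[OF A(1) B(1)])
    fix T :: "('f, ('f, 'a) test_universe) lla" and f' g'
    assume T: "compatible_homs c L A B T f' g'" "smult T = pm_scale"
    obtain l where l: "lla_hom U T l" "\<forall>x\<in>A. l (F x) = f' x" "\<forall>x\<in>B. l (G x) = g' x"
      using univ[OF T] by blast
    show "\<exists>h. lla_hom (induced_lla L (generated_lla L (A \<union> B))) T h \<and>
        (\<forall>x\<in>A. h x = f' x) \<and> (\<forall>x\<in>B. h x = g' x)"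
      using lla_hom_compose[OF k l(1)] l(2,3) h_A h_B
      by (intro exI[of _ "\<lambda>x. l (k x)"]) (auto simp: k_def S_def)
  qed
qed

section \<open>Descent along the series\<close>

text \<open>The sum A + P_j(C), written through its C-part.\<close>

definition thicken :: "('f::field, 'a::ab_group_add) lla \<Rightarrow> 'a set \<Rightarrow> 'a set \<Rightarrow> nat \<Rightarrow> 'a set"
  where "thicken L A C j = {x. \<exists>k\<in>layer L j \<inter> C. x - k \<in> A}"

context lla
begin

lemma thicken_antimono: "1 \<le> j \<Longrightarrow> thicken L A C (j + 1) \<subseteq> thicken L A C j"
  using layer_decreasing[of j "j + 1"] by (auto simp: thicken_def)

lemma thicken_subset:
  assumes "subspace A'" "A \<subseteq> A'" "C \<subseteq> A'"
  shows "thicken L A C j \<subseteq> A'"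
proof
  fix x assume "x \<in> thicken L A C j"
  then obtain k where "k \<in> C" "x - k \<in> A" by (auto simp: thicken_def)
  hence "(x - k) + k \<in> A'" using assms by (intro subspace_add[OF assms(1)]) auto
  thus "x \<in> A'" by simp
qed

lemma subset_thicken:
  assumes "subspace C" "1 \<le> j"
  shows "A \<subseteq> thicken L A C j"
  using subspace_0[OF assms(1)] subspace_0[OF subspace_layer[OF assms(2)]]
  by (force simp: thicken_def)

lemma layer_subset_thicken: "subspace A \<Longrightarrow> layer L j \<inter> C \<subseteq> thicken L A C j"
  using subspace_0[of A] by (force simp: thicken_def)

lemma thicken_above:
  assumes "subspace C" "j > c"
  shows "thicken L A C j = A"
  using subspace_0[OF assms(1)] layer_above[OF assms(2)] by (auto simp: thicken_def)

text \<open>A bracket in A' with one factor in layer j stays in layer j, so \<open>split\<close>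
  covers it. The only other products are those of two elements of A.\<close>

lemma sub_lla_thicken:
  assumes A: "sub_lla L A" "sub_lla L A'" "A \<subseteq> A'" and C: "sub_lla L C" "C \<subseteq> A'" and j: "1 \<le> j"
    and split: "layer L j \<inter> A' \<subseteq> thicken L A C j"
  shows "sub_lla L (thicken L A C j)"
proof -
  have A_sub: "subspace A" and A'_sub: "subspace A'" and C_sub: "subspace C"
    using A C by (auto intro: sub_lla_subspace)
  have sub: "subspace (thicken L A C j)"
    unfolding subspace_def
  proof (intro conjI ballI allI)
    show "0 \<in> thicken L A C j"
      using subset_thicken[OF C_sub j] subspace_0[OF A_sub] by auto
  next
    fix x y assume "x \<in> thicken L A C j" "y \<in> thicken L A C j"
    then obtain k l where kl: "k \<in> layer L j" "k \<in> C" "x - k \<in> A" "l \<in> layer L j" "l \<in> C" "y - l \<in> A"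
      by (auto simp: thicken_def)
    have "x + y - (k + l) \<in> A"
      using subspace_add[OF A_sub kl(3,6)] by (simp add: algebra_simps)
    moreover have "k + l \<in> layer L j \<inter> C"
      using kl subspace_add[OF subspace_layer[OF j]] subspace_add[OF C_sub] by auto
    ultimately show "x + y \<in> thicken L A C j"
      unfolding thicken_def by blast
  next
    fix r x assume "x \<in> thicken L A C j"
    then obtain k where k: "k \<in> layer L j" "k \<in> C" "x - k \<in> A"
      by (auto simp: thicken_def)
    have "smult L r x - smult L r k \<in> A"
      using subspace_scale[OF A_sub k(3), of r] by (simp add: scale_right_diff_distrib)
    moreover have "smult L r k \<in> layer L j \<inter> C"
      using k subspace_scale[OF subspace_layer[OF j]] subspace_scale[OF C_sub] by auto
    ultimately show "smult L r x \<in> thicken L A C j"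
      unfolding thicken_def by blast
  qed
  have in_A': "thicken L A C j \<subseteq> A'"
    using A'_sub A(3) C(2) by (rule thicken_subset)
  have carrier: "x \<in> carrier L" if "x \<in> A'" for x
    using that A(2) sub_lla_carrier by blast
  have deep: "bracket L x y \<in> thicken L A C j"
    if "x \<in> A'" "y \<in> A'" "x \<in> layer L j \<or> y \<in> layer L j" for x y
  proof -
    have "bracket L x y \<in> layer L j"
      using that(3)
    proof
      assume "x \<in> layer L j"
      hence "bracket L x y \<in> layer L (j + 1)"
        using j carrier[OF that(2)] by (intro bracket_layer) auto
      thus ?thesis using layer_decreasing[of j "j + 1"] j by auto
    next
      assume "y \<in> layer L j"
      hence "bracket L x y \<in> layer L (1 + j)"
        using j carrier[OF that(1)] by (intro bracket_layer) auto
      thus ?thesis using layer_decreasing[of j "1 + j"] j by auto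
    qed
    thus ?thesis using split sub_lla_bracket[OF A(2) that(1,2)] by auto
  qed
  have "bracket L x y \<in> thicken L A C j" if xy_mem: "x \<in> thicken L A C j" "y \<in> thicken L A C j" for x y
  proof -
    obtain k l where kl: "k \<in> layer L j" "k \<in> C" "x - k \<in> A" "l \<in> layer L j" "l \<in> C" "y - l \<in> A"
      using xy_mem unfolding thicken_def by blast
    define u where "u = x - k"
    define v where "v = y - l"
    have xy: "x = u + k" "y = v + l" by (simp_all add: u_def v_def)
    have uv: "u \<in> A" "v \<in> A" using kl by (simp_all add: u_def v_def)
    have mem: "u \<in> A'" "v \<in> A'" "k \<in> A'" "l \<in> A'" using uv kl A C by auto
    have "bracket L x y = bracket L u v + bracket L u l + bracket L k v + bracket L k l"
      using mem[THEN carrier] by (simp add: xy)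
    moreover have "bracket L u v \<in> thicken L A C j"
      using subset_thicken[OF C_sub j] sub_lla_bracket[OF A(1) uv] by auto
    ultimately show ?thesis
      using deep[OF mem(1,4)] deep[OF mem(3,2)] deep[OF mem(3,4)] kl
        subspace_add[OF sub] by auto
  qed
  thus ?thesis
    unfolding sub_lla_def using sub in_A' carrier by auto
qed

end

text \<open>The step is applied at layers 1, ..., c in turn. \<open>split_A\<close> and
  \<open>split_B\<close> at j + 1 are what the j-th step needs to see that the smaller algebras
  contain layer j + 1 of the larger ones.\<close>

lemma amalgam_extension_descends:
  fixes L :: "('f::field, 'a::ab_group_add) lla"
  assumes "is_lla c L"
    and A: "sub_lla L A" "sub_lla L A'" "A \<subseteq> A'"
    and B: "sub_lla L B" "sub_lla L B'" "B \<subseteq> B'"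
    and meet: "A \<inter> B' = A' \<inter> B"
    and split_A: "\<And>j. 1 \<le> j \<Longrightarrow> layer L j \<inter> A' \<subseteq> thicken L A (A' \<inter> B') j"
    and split_B: "\<And>j. 1 \<le> j \<Longrightarrow> layer L j \<inter> B' \<subseteq> thicken L B (A' \<inter> B') j"
    and ext: "amalgam_extension TYPE(('f, 'a) test_universe) c L A' B'"
  shows "amalgam_extension TYPE('t::ab_group_add) c L A B"
proof -
  interpret L: lla c L by unfold_locales fact
  define C where "C = A' \<inter> B'"
  define As where "As = thicken L A C"
  define Bs where "Bs = thicken L B C"
  have C: "sub_lla L C" "C \<subseteq> A'" "C \<subseteq> B'"
    using A B L.sub_lla_Int by (auto simp: C_def)
  note subsp = L.sub_lla_subspace
  have sub: "sub_lla L (As j)" "sub_lla L (Bs j)" if "1 \<le> j" for j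
    using L.sub_lla_thicken[OF A C(1,2) that] L.sub_lla_thicken[OF B C(1,3) that]
      split_A[OF that] split_B[OF that] by (simp_all add: As_def Bs_def C_def)
  have le: "As j \<subseteq> A'" "Bs j \<subseteq> B'" for j
    using L.thicken_subset[OF subsp[OF A(2)] A(3) C(2)] L.thicken_subset[OF subsp[OF B(2)] B(3) C(3)]
    by (simp_all add: As_def Bs_def)
  have ge: "A \<subseteq> As j" "B \<subseteq> Bs j" if "1 \<le> j" for j
    using L.subset_thicken[OF subsp[OF C(1)] that] by (simp_all add: As_def Bs_def)
  have K: "layer L j \<inter> C \<subseteq> layer L j \<inter> (As j \<inter> Bs j)" for j
    using A(1) B(1) L.layer_subset_thicken[OF subsp] unfolding As_def Bs_def by blast
  \<comment> \<open>The chain starts with \<open>As 1\<close> = A' and \<open>Bs 1\<close> = B', by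
    the splitting at layer 1, and ends at index c + 1 with A and B, because layer c + 1 is
    zero.\<close>
  have "amalgam_extension TYPE(('f, 'a) test_universe) c L (As j) (Bs j)" if "1 \<le> j" "j \<le> c + 1" for j
    using that
  proof (induction rule: dec_induct)
    case base
    have "As 1 = A'" "Bs 1 = B'"
      using le split_A[of 1] split_B[of 1] sub_lla_carrier[OF A(2)] sub_lla_carrier[OF B(2)]
      by (auto simp: As_def Bs_def C_def)
    thus ?case using ext by simp
  next
    case (step j)
    have IH: "amalgam_extension TYPE(('f, 'a) test_universe) c L (As j) (Bs j)"
      using step by simp
    have j: "1 \<le> j" "j \<le> c" "1 \<le> j + 1" using step by auto
    \<comment> \<open>The A-part x - k also lies in B', since both x and k do; so
      \<open>meet\<close> puts it in B, and the same k serves as witness. Thus \<open>meet\<close>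
      is inherited by neighbouring levels.\<close>
    have swap: "x \<in> Bs (j + 1)" if x: "x \<in> As (j + 1)" "x \<in> Bs j" for x
    proof -
      obtain k where k: "k \<in> layer L (j + 1) \<inter> C" "x - k \<in> A"
        using x by (auto simp: As_def thicken_def)
      have "x - k \<in> B'"
        using x le k C(3) by (intro L.subspace_diff[OF subsp[OF B(2)]]) auto
      thus ?thesis using k meet by (auto simp: Bs_def thicken_def)
    qed
    have swap': "x \<in> As (j + 1)" if x: "x \<in> Bs (j + 1)" "x \<in> As j" for x
    proof -
      obtain k where k: "k \<in> layer L (j + 1) \<inter> C" "x - k \<in> B"
        using x by (auto simp: Bs_def thicken_def)
      have "x - k \<in> A'"
        using x le k C(2) by (intro L.subspace_diff[OF subsp[OF A(2)]]) auto
      thus ?thesis using k meet by (auto simp: As_def thicken_def)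
    qed
    have anti: "As (j + 1) \<subseteq> As j" "Bs (j + 1) \<subseteq> Bs j"
      using L.thicken_antimono[OF j(1)] by (auto simp: As_def Bs_def)
    have "amalgam_extension TYPE(('f, 'a) test_universe) c L (As (j + 1)) (Bs (j + 1))"
    proof (rule amalgam_extension_step[OF assms(1) j(1,2) sub(1)[OF j(3)] sub(1)[OF j(1)] anti(1)
          sub(2)[OF j(3)] sub(2)[OF j(1)] anti(2) _ _ _ _ _ IH])
      show "As (j + 1) \<inter> Bs j = As j \<inter> Bs (j + 1)"
        using swap swap' anti by blast
      show "\<exists>k\<in>layer L j \<inter> (As j \<inter> Bs j). x - k \<in> As (j + 1)" if x: "x \<in> As j" for x
      proof -
        obtain k where "k \<in> layer L j \<inter> C" "x - k \<in> A"
          using x by (auto simp: As_def thicken_def)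
        thus ?thesis using K[of j] ge(1)[OF j(3)] by blast
      qed
      show "\<exists>k\<in>layer L j \<inter> (As j \<inter> Bs j). x - k \<in> Bs (j + 1)" if x: "x \<in> Bs j" for x
      proof -
        obtain k where "k \<in> layer L j \<inter> C" "x - k \<in> B"
          using x by (auto simp: Bs_def thicken_def)
        thus ?thesis using K[of j] ge(2)[OF j(3)] by blast
      qed
      show "As j \<inter> layer L (j + 1) \<subseteq> As (j + 1)" "Bs j \<inter> layer L (j + 1) \<subseteq> Bs (j + 1)"
        using split_A[OF j(3)] split_B[OF j(3)] le[of j] by (auto simp: As_def Bs_def C_def)
    qed
    thus ?case by (simp only: Suc_eq_plus1)
  qed
  from this[of "c + 1"]
  have "amalgam_extension TYPE(('f, 'a) test_universe) c L A B"
    using L.thicken_above[OF subsp[OF C(1)], of "c + 1"] by (simp add: As_def Bs_def)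
  thus ?thesis by (rule amalgam_extension_any_type[OF A(1) B(1)])
qed

section \<open>Malcev tuples\<close>

text \<open>The Malcev equation at j writes x as k + s with k in C and s a combination of entries of
  a from layer j. Then s lies in A and in layer j, hence k = x - s lies in layer j too. Beyond c the
  layer is zero.\<close>

lemma malcev_layer_subset_thicken:
  fixes L :: "('f::field, 'a::ab_group_add) lla"
  assumes "is_lla c L" "sub_lla L C" "sub_lla L A" "set a \<subseteq> A" "malcev c L C a" "1 \<le> j"
  shows "layer L j \<inter> generated_lla L (C \<union> set a) \<subseteq> thicken L A C j"
proof
  interpret L: lla c L by unfold_locales fact
  have C: "L.subspace C" and A: "L.subspace A" and P: "L.subspace (layer L j)"
    using assms by (auto intro: L.sub_lla_subspace L.subspace_layer)
  fix x assume x: "x \<in> layer L j \<inter> generated_lla L (C \<union> set a)"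
  show "x \<in> thicken L A C j"
  proof (cases "j \<le> c")
    case True
    have "x \<in> L.span (C \<union> (layer L j \<inter> generated_lla L (C \<union> set a)))"
      using x by (intro L.span_base) auto
    also have "\<dots> = L.span (C \<union> (layer L j \<inter> set a))"
      using assms(5,6) True by (simp add: malcev_def)
    finally obtain k s where ks: "x = k + s" "k \<in> L.span C" "s \<in> L.span (layer L j \<inter> set a)"
      unfolding L.span_Un by auto
    have "s \<in> layer L j"
      using ks(3) L.span_minimal[OF _ P, of "layer L j \<inter> set a"] by blast
    moreover have "s \<in> A"
      using ks(3) L.span_minimal[OF _ A, of "layer L j \<inter> set a"] assms(4) by blast
    moreover have "k \<in> C"
      using ks(2) L.span_minimal[OF _ C, of C] by blast
    moreover have "k \<in> layer L j"
      using L.subspace_diff[OF P, of x s] x ks(1) \<open>s \<in> layer L j\<close> by simp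
    ultimately show ?thesis
      using ks(1) by (auto simp: thicken_def intro!: bexI[of _ k])
  next
    case False
    hence "x = 0" using x L.layer_above[of j] by simp
    thus ?thesis
      using L.subspace_0[OF A] L.subset_thicken[OF C assms(6), of A] by auto
  qed
qed

text \<open>The Malcev equation over E at layer 1, available as c \<ge> 1, says that every element
  generated by E and a is some e in E plus a combination of a. If the element lies in C, so does the
  combination, and independence over C kills it.\<close>

lemma malcev_generated_Int:
  fixes L :: "('f::field, 'a::ab_group_add) lla"
  assumes "is_lla c L" "1 \<le> c" "sub_lla L E" "sub_lla L C" "E \<subseteq> C" "set a \<subseteq> carrier L"
    and "malcev c L E a" "linearly_independent_over L C a"
  shows "generated_lla L (E \<union> set a) \<inter> C = E"
proof
  interpret L: lla c L by unfold_locales fact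
  have E: "L.subspace E" and C: "L.subspace C"
    using assms by (auto intro: L.sub_lla_subspace)
  \<comment> \<open>E plus the span of a, with the coefficients spelled out in the form that
    \<open>linearly_independent_over\<close> speaks of.\<close>
  define V where "V = {e + (\<Sum>k<length a. smult L (r k) (a ! k)) | e r. e \<in> E}"
  have "L.subspace V"
    unfolding L.subspace_def
  proof (intro conjI ballI allI)
    show "0 \<in> V"
      using L.subspace_0[OF E] unfolding V_def by (auto intro!: exI[of _ 0] exI[of _ "\<lambda>_. 0"])
    fix x y assume "x \<in> V" "y \<in> V"
    then obtain e r f s where "x = e + (\<Sum>k<length a. smult L (r k) (a ! k))" "e \<in> E"
        "y = f + (\<Sum>k<length a. smult L (s k) (a ! k))" "f \<in> E"
      by (auto simp: V_def)
    thus "x + y \<in> V"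
      unfolding V_def using L.subspace_add[OF E]
      by (intro CollectI exI[of _ "e + f"] exI[of _ "\<lambda>k. r k + s k"])
        (simp add: L.scale_left_distrib sum.distrib algebra_simps)
  next
    fix q x assume "x \<in> V"
    then obtain e r where "x = e + (\<Sum>k<length a. smult L (r k) (a ! k))" "e \<in> E"
      by (auto simp: V_def)
    thus "smult L q x \<in> V"
      unfolding V_def using L.subspace_scale[OF E]
      by (intro CollectI exI[of _ "smult L q e"] exI[of _ "\<lambda>k. q * r k"])
        (simp add: L.scale_right_distrib L.scale_sum_right)
  qed
  moreover have "E \<subseteq> V"
    unfolding V_def by (auto intro!: exI[of _ "\<lambda>_. 0"])
  moreover have "set a \<subseteq> V"
  proof
    fix x assume "x \<in> set a"
    then obtain l where l: "l < length a" "x = a ! l" by (metis in_set_conv_nth)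
    have "(\<Sum>k<length a. smult L (if k = l then 1 else 0) (a ! k)) =
        (\<Sum>k<length a. if k = l then a ! k else 0)"
      by (intro sum.cong) auto
    hence "x = 0 + (\<Sum>k<length a. smult L (if k = l then 1 else 0) (a ! k))"
      using l by simp
    thus "x \<in> V" unfolding V_def using L.subspace_0[OF E]
      by (intro CollectI exI[of _ 0] exI[of _ "\<lambda>k. if k = l then 1 else 0"] conjI)
  qed
  ultimately have span: "L.span (E \<union> (layer L 1 \<inter> set a)) \<subseteq> V"
    by (intro L.span_minimal) auto
  have gen: "generated_lla L (E \<union> set a) \<subseteq> carrier L"
    using assms(6) sub_lla_carrier[OF assms(3)]
    by (intro sub_lla_carrier[OF L.sub_lla_generated]) auto
  show "generated_lla L (E \<union> set a) \<inter> C \<subseteq> E"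
  proof
    fix x assume x: "x \<in> generated_lla L (E \<union> set a) \<inter> C"
    hence "x \<in> L.span (E \<union> (layer L 1 \<inter> generated_lla L (E \<union> set a)))"
      using gen by (intro L.span_base) auto
    also have "\<dots> = L.span (E \<union> (layer L 1 \<inter> set a))"
      using assms(2,7) by (simp add: malcev_def)
    finally obtain e r where er: "x = e + (\<Sum>k<length a. smult L (r k) (a ! k))" "e \<in> E"
      using span by (auto simp: V_def)
    have "x - e \<in> C"
      using x er(2) assms(5) by (intro L.subspace_diff[OF C]) auto
    hence "(\<Sum>k<length a. smult L (r k) (a ! k)) \<in> C"
      using er(1) by simp
    hence "\<forall>k<length a. r k = 0"
      using assms(8) by (auto simp: linearly_independent_over_def)
    thus "x \<in> E" using er by simp
  qed
  show "E \<subseteq> generated_lla L (E \<union> set a) \<inter> C"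
    using generated_incl[of "E \<union> set a" L] assms(5) by auto
qed

section \<open>Free independence as intersection plus extension property\<close>

lemma lla_embedding_inclusion:
  assumes "D \<subseteq> S"
  shows "lla_embedding (induced_lla L D) (induced_lla L S) id"
  using assms by (auto simp: lla_embedding_def lla_hom_def)

text \<open>For inclusions inside L, the embedding and generation clauses hold by construction, and
  uniqueness holds because A and B generate S. What remains is the intersection and the existence of
  extensions.\<close>

lemma free_indepI:
  fixes L :: "('f::field, 'a::ab_group_add) lla"
  assumes "is_lla c L" "sub_lla L E" "X \<subseteq> carrier L" "Y \<subseteq> carrier L"
    and meet: "generated_lla L (X \<union> E) \<inter> generated_lla L (Y \<union> E) = E"
    and ext: "amalgam_extension TYPE('t::ab_group_add) c L
      (generated_lla L (X \<union> E)) (generated_lla L (Y \<union> E))"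
  shows "free_indep TYPE('t) c L E X Y"
proof -
  interpret L: lla c L by unfold_locales fact
  define A where "A = generated_lla L (X \<union> E)"
  define B where "B = generated_lla L (Y \<union> E)"
  define S where "S = generated_lla L (X \<union> Y \<union> E)"
  have E_carrier: "E \<subseteq> carrier L" using assms(2) by (rule sub_lla_carrier)
  have A: "sub_lla L A" and B: "sub_lla L B" and S: "sub_lla L S"
    using assms E_carrier unfolding A_def B_def S_def by (auto intro!: L.sub_lla_generated)
  have AS: "A \<subseteq> S" "B \<subseteq> S"
    unfolding A_def B_def S_def by (auto intro!: generated_mono)
  have EA: "E \<subseteq> A" "X \<subseteq> A" and EB: "E \<subseteq> B" "Y \<subseteq> B"
    using generated_incl[of "X \<union> E" L] generated_incl[of "Y \<union> E" L] by (auto simp: A_def B_def)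
  have gen: "generated_lla L (A \<union> B) = S"
  proof
    show "generated_lla L (A \<union> B) \<subseteq> S" using AS S by (intro generated_minimal) auto
    show "S \<subseteq> generated_lla L (A \<union> B)"
      unfolding S_def using EA EB by (intro generated_mono) auto
  qed
  have gen': "generated_lla (induced_lla L S) (A \<union> B) = S"
    using L.generated_induced[of "A \<union> B" S] AS S gen by simp
  note c = carrier_induced[OF A] carrier_induced[OF B] carrier_induced[OF S]
  have "free_amalgam TYPE('t) c (induced_lla L S) (induced_lla L A) id (induced_lla L B) id E"
    unfolding free_amalgam_def c
  proof (intro conjI allI impI)
    show "is_lla c (induced_lla L S)" "is_lla c (induced_lla L A)" "is_lla c (induced_lla L B)"
      using A B S by (auto intro!: L.is_lla_induced)
    show "common_sub_lla (induced_lla L A) (induced_lla L B) E"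
      using assms(2) EA EB by (auto simp: common_sub_lla_def sub_lla_induced)
    show "lla_embedding (induced_lla L A) (induced_lla L S) id"
      "lla_embedding (induced_lla L B) (induced_lla L S) id"
      using AS by (auto intro!: lla_embedding_inclusion)
    show "generated_lla (induced_lla L S) (id ` A \<union> id ` B) = S"
      using gen' by simp
    show "id ` A \<inter> id ` B = id ` E"
      using meet by (simp add: A_def B_def)
  next
    fix T :: "('f, 't) lla" and f g
    assume T: "is_lla c T \<and> lla_hom (induced_lla L A) T f \<and> lla_hom (induced_lla L B) T g \<and>
      (\<forall>d\<in>E. f d = g d)"
    hence "compatible_homs c L A B T f g"
      using meet by (simp add: compatible_homs_def A_def B_def)
    then obtain h where h: "lla_hom (induced_lla L S) T h" "\<forall>x\<in>A. h x = f x" "\<forall>x\<in>B. h x = g x"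
      using ext gen unfolding amalgam_extension_def by (fold A_def B_def) blast
    have "h' x = h x"
      if h': "lla_hom (induced_lla L S) T h'" "\<forall>x\<in>A. h' (id x) = f x" "\<forall>x\<in>B. h' (id x) = g x"
        and "x \<in> S" for h' x
    proof (rule hom_eq_on_generated[OF L.is_lla_induced[OF S] _ h'(1) h(1)])
      show "x \<in> generated_lla (induced_lla L S) (A \<union> B)" using gen' that by simp
      show "A \<union> B \<subseteq> carrier (induced_lla L S)" unfolding c using AS by auto
      show "h' y = h y" if "y \<in> A \<union> B" for y
        using that h h' by auto
    qed (use T in simp)
    thus "\<exists>h. (lla_hom (induced_lla L S) T h \<and> (\<forall>x\<in>A. h (id x) = f x) \<and> (\<forall>x\<in>B. h (id x) = g x)) \<and>
        (\<forall>h'. lla_hom (induced_lla L S) T h' \<and> (\<forall>x\<in>A. h' (id x) = f x) \<and> (\<forall>x\<in>B. h' (id x) = g x)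
          \<longrightarrow> (\<forall>x\<in>S. h' x = h x))"
    proof (intro exI[of _ h] conjI allI impI)
      show "lla_hom (induced_lla L S) T h" "\<forall>x\<in>A. h (id x) = f x" "\<forall>x\<in>B. h (id x) = g x"
        using h by simp_all
    qed blast
  qed simp
  thus ?thesis by (simp add: free_indep_def A_def B_def S_def)
qed

lemma free_indepD:
  fixes L :: "('f::field, 'a::ab_group_add) lla"
  assumes "is_lla c L" "sub_lla L E" "X \<subseteq> carrier L" "Y \<subseteq> carrier L"
    and indep: "free_indep TYPE('t::ab_group_add) c L E X Y"
  shows "generated_lla L (X \<union> E) \<inter> generated_lla L (Y \<union> E) = E" (is "?meet")
    and "amalgam_extension TYPE('t) c L (generated_lla L (X \<union> E)) (generated_lla L (Y \<union> E))" (is "?ext")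
proof -
  interpret L: lla c L by unfold_locales fact
  define A where "A = generated_lla L (X \<union> E)"
  define B where "B = generated_lla L (Y \<union> E)"
  define S where "S = generated_lla L (X \<union> Y \<union> E)"
  have E_carrier: "E \<subseteq> carrier L" using assms(2) by (rule sub_lla_carrier)
  have A: "sub_lla L A" and B: "sub_lla L B" and S: "sub_lla L S"
    using assms E_carrier unfolding A_def B_def S_def by (auto intro!: L.sub_lla_generated)
  note c = carrier_induced[OF A] carrier_induced[OF B] carrier_induced[OF S]
  have am: "free_amalgam TYPE('t) c (induced_lla L S) (induced_lla L A) id (induced_lla L B) id E"
    using indep by (simp add: free_indep_def A_def B_def S_def)
  hence meet: "A \<inter> B = E"
    unfolding free_amalgam_def c by simp
  thus ?meet by (simp add: A_def B_def)
  have AS: "A \<union> B \<subseteq> S"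
    unfolding A_def B_def S_def by (auto intro!: generated_mono)
  have gen: "generated_lla L (A \<union> B) \<subseteq> S"
    using AS S by (rule generated_minimal)
  have "\<exists>h. lla_hom (induced_lla L (generated_lla L (A \<union> B))) T h \<and>
      (\<forall>x\<in>A. h x = f x) \<and> (\<forall>x\<in>B. h x = g x)"
    if fg: "compatible_homs c L A B T f g" for T :: "('f, 't) lla" and f g
  proof -
    have "is_lla c T \<and> lla_hom (induced_lla L A) T f \<and> lla_hom (induced_lla L B) T g \<and>
        (\<forall>d\<in>E. f d = g d)"
      using fg meet by (simp add: compatible_homs_def)
    with am have "\<exists>h. lla_hom (induced_lla L S) T h \<and>
        (\<forall>x\<in>A. h (id x) = f x) \<and> (\<forall>x\<in>B. h (id x) = g x)"
      unfolding free_amalgam_def c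
      by (elim conjE) (erule allE[of _ T], erule allE[of _ f], erule allE[of _ g], blast)
    then obtain h where h: "lla_hom (induced_lla L S) T h" "\<forall>x\<in>A. h x = f x" "\<forall>x\<in>B. h x = g x"
      by auto
    have "lla_hom (induced_lla L (generated_lla L (A \<union> B))) T h"
      using lla_hom_restrict[OF h(1), of "generated_lla L (A \<union> B)"] gen
      by (simp add: induced_lla_def Int_absorb1 inf_assoc)
    thus ?thesis using h by blast
  qed
  thus ?ext by (simp add: amalgam_extension_def A_def B_def)
qed

theorem theorem4p48:
  fixes c :: nat
    and L :: "('f::field, 'a::ab_group_add) lla"
    and C E :: "'a set"
    and a b :: "'a list"
  assumes "c \<ge> 1"
    and "is_lla c L"
    and "sub_lla L C" and "sub_lla L E" and "E \<subseteq> C"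
    and "set a \<subseteq> carrier L" and "set b \<subseteq> carrier L"
    and "malcev c L C a" and "malcev c L E a"
    and "malcev c L C b" and "malcev c L E b"
    and "free_indep TYPE(('f, 'a) test_universe) c L C (set a) (set b)"
  shows "free_indep TYPE('t::ab_group_add) c L E (set a) (set b)"
proof -
  interpret L: lla c L by unfold_locales fact
  define A where "A = generated_lla L (set a \<union> E)"
  define B where "B = generated_lla L (set b \<union> E)"
  define A' where "A' = generated_lla L (set a \<union> C)"
  define B' where "B' = generated_lla L (set b \<union> C)"
  have carrier: "C \<subseteq> carrier L" "E \<subseteq> carrier L"
    using assms(3,4) by (auto dest: sub_lla_carrier)
  have sub: "sub_lla L A" "sub_lla L B" "sub_lla L A'" "sub_lla L B'"
    using assms(6,7) carrier unfolding A_def B_def A'_def B'_def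
    by (auto intro!: L.sub_lla_generated)
  have le: "A \<subseteq> A'" "B \<subseteq> B'"
    using assms(5) unfolding A_def B_def A'_def B'_def by (auto intro!: generated_mono)
  have incl: "set a \<subseteq> A" "E \<subseteq> A" "set b \<subseteq> B" "E \<subseteq> B"
    using generated_incl[of "set a \<union> E" L] generated_incl[of "set b \<union> E" L]
    by (auto simp: A_def B_def)
  have meet': "A' \<inter> B' = C" and ext: "amalgam_extension TYPE(('f, 'a) test_universe) c L A' B'"
    using free_indepD[OF assms(2,3,6,7,12)] by (simp_all add: A'_def B'_def)
  \<comment> \<open>Here both Malcev conditions enter: the layer equation over E and linear
    independence over C.\<close>
  have AC: "A \<inter> C = E" "B \<inter> C = E"
    using malcev_generated_Int[OF assms(2,1,4,3,5,6,9)] malcev_generated_Int[OF assms(2,1,4,3,5,7,11)]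
      assms(8,10) by (simp_all add: A_def B_def malcev_def Un_commute)
  \<comment> \<open>The Malcev equations over C, with C recognised as A' \<inter> B'.\<close>
  have split_A: "layer L j \<inter> A' \<subseteq> thicken L A (A' \<inter> B') j" if "1 \<le> j" for j
    using malcev_layer_subset_thicken[OF assms(2,3) sub(1) incl(1) assms(8) that]
    unfolding meet' by (simp add: A'_def Un_commute)
  have split_B: "layer L j \<inter> B' \<subseteq> thicken L B (A' \<inter> B') j" if "1 \<le> j" for j
    using malcev_layer_subset_thicken[OF assms(2,3) sub(2) incl(3) assms(10) that]
    unfolding meet' by (simp add: B'_def Un_commute)
  \<comment> \<open>An element of A \<inter> B' lies in A' \<inter> B' = C, hence in A \<inter> C =
    E; symmetrically for A' \<inter> B. Both sides are E.\<close>
  have meet: "A \<inter> B' = A' \<inter> B"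
    using AC meet' le incl by blast
  have "amalgam_extension TYPE('t) c L A B"
    by (rule amalgam_extension_descends[OF assms(2) sub(1,3) le(1) sub(2,4) le(2) meet
          split_A split_B ext])
  moreover have "A \<inter> B = E"
    using AC meet' le incl by blast
  ultimately show ?thesis
    using assms(2,4,6,7) by (intro free_indepI) (simp_all add: A_def B_def)
qed

end
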